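(* For every $n \ge 1$, the polynomial $f^+_n(x)$ is equal to the local $h$-polynomial $\ell_{[n]}(K_n, x)$ of the simplicial subdivision $K_n$ of the simplex $2^{[n]}$. In particular, $f^+_n$ has nonnegative, symmetric and unimodal coefficients. Moreover, for every $n \in \mathbb{N}$, $$ f^+_n(x) = \sum_{k=0}^n (-1)^{n-k} \binom{n}{k} B^+_k(x) \quad\text{and}\quad f^-_n(x) = \sum_{k=0}^n (-1)^{n-k} \binom{n}{k} B^-_k(x). $$
   Context: Signed permutations: a signed permutation of $[n]$ is a set $S = \{a_1, \dots, a_n\}$ with $a_i \in \{i, -i\}$, together with a bijection $w : S \to S$, written as the word $w(a_1) \cdots w(a_n)$. The set of these is $B_n$. - An index $i \in \{0, \dots, n-1\}$ is a $B$-descent if $w(a_i) > w(a_{i+1})$, with the convention $w(a_0) = 0$; $\mathrm{des}_B(w)$ is the number of $B$-descents. - $B^+_n$ (resp. $B^-_n$) is the set of $w \in B_n$ with $w(a_n) > 0$ (resp. $< 0$). - $B^\pm_n(x) = \sum_{w \in B^\pm_n} x^{\mathrm{des}_B(w)}$, with $B^+_0(x) = 1$ and $B^-_0(x) = 0$. - $a \in S$ is a $B$-excedance if $w(a) > a$, or if $a < 0$ and $w(a) = a$. - $w$ is a derangement if no $a \in S$ with $a > 0$ satisfies $w(a) = a$. - $d^B_n(x) = \sum_{w \text{ derangement}} x^{\mathrm{exc}_B(w)}$, with $d^B_0 = 1$. - $f^+_n, f^-_n$ are the unique real polynomials with $d^B_n = f^+_n + f^-_n$, $f^+_n(x) = x^n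 f^+_n(1/x)$ and $f^-_n(x) = x^{n+1} f^-_n(1/x)$. Face enumeration: for a simplicial complex $\Delta$ of dimension $d-1$, the $h$-polynomial is $h(\Delta, x) = \sum_{F \in \Delta} x^{|F|} (1-x)^{d-|F|}$. Subdivisions: a simplicial subdivision of the simplex $2^V$ (with $|V| = d$) is a simplicial complex $\Gamma$ with a map $\sigma : \Gamma \to 2^V$ such that, for every $F \subseteq V$, the restriction $\Gamma_F = \sigma^{-1}(2^F)$ is a subcomplex homeomorphic to a ball of dimension $|F|-1$ whose interior is $\sigma^{-1}(F)$. Its local $h$-polynomial is $$ \ell_V(\Gamma, x) = \sum_{F \subseteq V} (-1)^{d-|F|}\, h(\Gamma_F, x). $$ $K_n$: let $P$ be the set of intervals $[A, B]$ with $\emptyset \ne A \subseteq B \subseteq [n]$ (intervals in the Boolean lattice), ordered by inclusion: $[A, B] \le [A', B']$ iff $A' \subseteq A$ and $B \subseteq B'$. $K_n$ is the order complex of $P$, i.e. the simplicial complex of chains of $P$. It is a simplicial subdivision of $2^{[n]}$ via the carrier map sending a nonempty chain to the set $B$ of its largest element $[A, B]$, and the empty chain to $\emptyset$. *)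

theory Defs
  imports "HOL-Computational_Algebra.Polynomial"
begin

text \<open>A signed permutation of [n] is a pair (S, w): S = {a_1,...,a_n} with a_i in {i,-i},
  and w a bijection S -> S (normalised to be the identity outside S).\<close>

definition signed_perms :: "nat \<Rightarrow> (int set \<times> (int \<Rightarrow> int)) set" where
  "signed_perms n = {(S, w).
     (\<exists>a :: nat \<Rightarrow> int. (\<forall>i\<in>{1..n}. a i = int i \<or> a i = - int i) \<and> S = a ` {1..n}) \<and>
     bij_betw w S S \<and> (\<forall>x. x \<notin> S \<longrightarrow> w x = x)}"

definition sa :: "int set \<Rightarrow> nat \<Rightarrow> int" where
  "sa S i = (if int i \<in> S then int i else - int i)"

definition wval :: "int set \<Rightarrow> (int \<Rightarrow> int) \<Rightarrow> nat \<Rightarrow> int" where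
  "wval S w i = (if i = 0 then 0 else w (sa S i))"

definition desB :: "nat \<Rightarrow> int set \<Rightarrow> (int \<Rightarrow> int) \<Rightarrow> nat" where
  "desB n S w = card {i \<in> {0..<n}. wval S w i > wval S w (Suc i)}"

definition Bplus :: "nat \<Rightarrow> real poly" where
  "Bplus n = (if n = 0 then 1 else
     (\<Sum>p\<in>{p \<in> signed_perms n. snd p (sa (fst p) n) > 0}. monom 1 (desB n (fst p) (snd p))))"

definition Bminus :: "nat \<Rightarrow> real poly" where
  "Bminus n = (if n = 0 then 0 else
     (\<Sum>p\<in>{p \<in> signed_perms n. snd p (sa (fst p) n) < 0}. monom 1 (desB n (fst p) (snd p))))"

definition excB :: "int set \<Rightarrow> (int \<Rightarrow> int) \<Rightarrow> nat" where
  "excB S w = card {a \<in> S. w a > a \<or> (a < 0 \<and> w a = a)}"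

definition is_derangement :: "int set \<Rightarrow> (int \<Rightarrow> int) \<Rightarrow> bool" where
  "is_derangement S w \<longleftrightarrow> (\<forall>a\<in>S. a > 0 \<longrightarrow> w a \<noteq> a)"

definition dB :: "nat \<Rightarrow> real poly" where
  "dB n = (if n = 0 then 1 else
     (\<Sum>p\<in>{p \<in> signed_perms n. is_derangement (fst p) (snd p)}. monom 1 (excB (fst p) (snd p))))"

definition fpm_decomp :: "nat \<Rightarrow> real poly \<Rightarrow> real poly \<Rightarrow> bool" where
  "fpm_decomp n fp fm \<longleftrightarrow> dB n = fp + fm \<and>
     (\<forall>x::real. x \<noteq> 0 \<longrightarrow> poly fp x = x ^ n * poly fp (1 / x)) \<and>
     (\<forall>x::real. x \<noteq> 0 \<longrightarrow> poly fm x = x ^ (n + 1) * poly fm (1 / x))"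

definition fplus :: "nat \<Rightarrow> real poly" where
  "fplus n = fst (THE pq. fpm_decomp n (fst pq) (snd pq))"

definition fminus :: "nat \<Rightarrow> real poly" where
  "fminus n = snd (THE pq. fpm_decomp n (fst pq) (snd pq))"

text \<open>h-polynomial of a simplicial complex (given as its set of faces, including the empty face);
  d = dim + 1 = maximal face size.\<close>
definition h_poly :: "'a set set \<Rightarrow> real poly" where
  "h_poly \<Delta> = (let d = Max (card ` \<Delta>) in
     (\<Sum>F\<in>\<Delta>. monom 1 (card F) * [:1, -1:] ^ (d - card F)))"

definition local_h :: "'b set \<Rightarrow> 'a set set \<Rightarrow> ('a set \<Rightarrow> 'b set) \<Rightarrow> real poly" where
  "local_h V \<Gamma> \<sigma> = (\<Sum>F\<in>Pow V. smult ((-1) ^ (card V - card F)) (h_poly {G \<in> \<Gamma>. \<sigma> G \<subseteq> F}))"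

definition intervals :: "nat \<Rightarrow> (nat set \<times> nat set) set" where
  "intervals n = {(A, B). A \<noteq> {} \<and> A \<subseteq> B \<and> B \<subseteq> {1..n}}"

definition int_le :: "nat set \<times> nat set \<Rightarrow> nat set \<times> nat set \<Rightarrow> bool" where
  "int_le p q \<longleftrightarrow> fst q \<subseteq> fst p \<and> snd p \<subseteq> snd q"

definition K :: "nat \<Rightarrow> (nat set \<times> nat set) set set" where
  "K n = {c. c \<subseteq> intervals n \<and> (\<forall>p\<in>c. \<forall>q\<in>c. int_le p q \<or> int_le q p)}"

definition K_carrier :: "(nat set \<times> nat set) set \<Rightarrow> nat set" where
  "K_carrier c = (if c = {} then {} else snd (THE m. m \<in> c \<and> (\<forall>p\<in>c. int_le p m)))"

definition unimodal_upto :: "real poly \<Rightarrow> nat \<Rightarrow> bool" where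
  "unimodal_upto p n \<longleftrightarrow> (\<exists>k\<le>n. (\<forall>i<k. coeff p i \<le> coeff p (Suc i)) \<and>
                                  (\<forall>i. k \<le> i \<and> i < n \<longrightarrow> coeff p (Suc i) \<le> coeff p i))"

end

theory Submission
  imports Defs "HOL-Combinatorics.Permutations" "HOL-Computational_Algebra.Polynomial_FPS"
begin

text \<open>
  Write \<open>P\<^sub>n\<close> and \<open>M\<^sub>n\<close> for the alternating binomial sums of the \<open>B\<^sup>+\<^sub>k\<close> and the \<open>B\<^sup>-\<^sub>k\<close>.

  Cutting a signed word at its descents and at some of its ascents turns it into a sequence of signed
  blocks, which gives recursions for \<open>B\<^sub>n = B\<^sup>+\<^sub>n + B\<^sup>-\<^sub>n\<close> and \<open>B\<^sup>+\<^sub>n\<close>. Sorting the chains of \<open>K\<^sub>n\<close> by their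
  largest interval gives the same recursions, so the restriction of \<open>K\<^sub>n\<close> to \<open>F\<close> has h-polynomial
  \<open>B\<^sup>+\<close> with index \<open>card F\<close>, and the local h-polynomial is \<open>P\<^sub>n\<close>. Inserting the letters \<open>n + 1\<close> and
  \<open>- (n + 1)\<close> into cycles shows that B-excedances are distributed as B-descents, and
  inclusion-exclusion over the positive fixed points gives \<open>d\<^sub>n = P\<^sub>n + M\<^sub>n\<close>.

  The exponential generating functions of \<open>P\<close> and \<open>M\<close> are
  \<open>(e\<^bsup>xt\<^esup> - x e\<^sup>t) / (e\<^bsup>2xt\<^esup> - x e\<^bsup>2t\<^esup>)\<close> and \<open>x (e\<^sup>t - e\<^bsup>xt\<^esup>) / (e\<^bsup>2xt\<^esup> - x e\<^bsup>2t\<^esup>)\<close>. Dividing numerator and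
  denominator by \<open>1 - x\<close> yields recursions with the coefficients \<open>q\<^sub>k = x + \<dots> + x\<^bsup>k - 1\<^esup>\<close>, from which the
  symmetry of \<open>P\<^sub>n\<close> and \<open>M\<^sub>n\<close> and the nonnegativity and unimodality of \<open>P\<^sub>n\<close> follow by induction.
\<close>

section \<open>Signed sets and signed words\<close>

text \<open>The type B Eulerian polynomial \<open>B\<^sup>+\<^sub>n + B\<^sup>-\<^sub>n\<close>; the recursion removes the last block of a
  sequence of signed blocks, where \<open>n - k\<close> is the size of that block.\<close>

fun eB :: "nat \<Rightarrow> real poly" where
  "eB n = [:1, -1:] ^ n + (\<Sum>k<n. of_nat (n choose k) * 2 ^ (n - k) *
     ([:0, 1:] * [:1, -1:] ^ (n - k - 1) * eB k))"

declare eB.simps [simp del]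

section \<open>Sums over subsets, grouped by cardinality\<close>

lemma sum_Pow_by_card:
  fixes f :: "nat \<Rightarrow> 'b::comm_semiring_1"
  assumes "finite N"
  shows "(\<Sum>M\<in>Pow N. f (card M)) = (\<Sum>k\<le>card N. of_nat (card N choose k) * f k)"
proof -
  have "(\<Sum>M\<in>Pow N. f (card M)) = (\<Sum>k\<le>card N. \<Sum>M\<in>{M \<in> Pow N. card M = k}. f (card M))"
    using assms by (intro sum.group [symmetric]) (auto simp: card_mono)
  also have "\<dots> = (\<Sum>k\<le>card N. of_nat (card N choose k) * f k)"
  proof (rule sum.cong[OF refl])
    fix k
    have "(\<Sum>M\<in>{M \<in> Pow N. card M = k}. f (card M)) = (\<Sum>M\<in>{M \<in> Pow N. card M = k}. f k)"
      by (rule sum.cong) auto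
    then show "(\<Sum>M\<in>{M \<in> Pow N. card M = k}. f (card M)) = of_nat (card N choose k) * f k"
      using n_subsets[OF assms, of k] by simp
  qed
  finally show ?thesis .
qed

lemma sum_proper_subsets_by_card:
  fixes f :: "nat \<Rightarrow> 'b::comm_ring_1"
  assumes "finite N"
  shows "(\<Sum>M\<in>Pow N - {N}. f (card M)) = (\<Sum>k<card N. of_nat (card N choose k) * f k)"
  using sum_Pow_by_card[OF assms, of f] assms
  by (simp add: sum_diff1 flip: lessThan_Suc_atMost)

section \<open>Structure and enumeration of signed sets\<close>

definition signed_sets :: "int set \<Rightarrow> int set set" where
  "signed_sets N = {S. abs ` S = N \<and> inj_on abs S}"

definition signed_words :: "int set \<Rightarrow> int list set" where
  "signed_words N = {l. distinct l \<and> set l \<in> signed_sets N}"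

text \<open>The prefixed 0 realises the convention \<open>w(a_0) = 0\<close>: position
  \<open>i\<close> compares a letter with its predecessor, and the first letter with 0.\<close>

definition word_des :: "int list \<Rightarrow> nat" where
  "word_des l = card {i. i < length l \<and> (0 # l) ! i > l ! i}"

lemma signed_sets_empty: "signed_sets {} = {{}}"
  by (auto simp: signed_sets_def)

lemma finite_signed_sets:
  assumes "finite N" shows "finite (signed_sets N)"
proof (rule finite_subset)
  show "signed_sets N \<subseteq> Pow (N \<union> uminus ` N)"
  proof (intro subsetI PowI)
    fix S s assume "S \<in> signed_sets N" "s \<in> S"
    then have "\<bar>s\<bar> \<in> N" by (auto simp: signed_sets_def)
    then show "s \<in> N \<union> uminus ` N" by (cases "s \<ge> 0") (auto intro: image_eqI[of _ _ "- s"])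
  qed
qed (use assms in auto)

lemma signed_sets_finite: "finite N \<Longrightarrow> S \<in> signed_sets N \<Longrightarrow> finite S"
  by (auto simp: signed_sets_def dest: finite_imageD)

lemma signed_sets_card: "S \<in> signed_sets N \<Longrightarrow> card S = card N"
  by (auto simp: signed_sets_def card_image)

lemma signed_sets_insert:
  assumes "m > 0" "m \<notin> N"
  shows "signed_sets (insert m N) = insert m ` signed_sets N \<union> insert (- m) ` signed_sets N"
proof (intro equalityI subsetI)
  fix S assume "S \<in> signed_sets (insert m N)"
  then have S: "abs ` S = insert m N" "inj_on abs S" by (auto simp: signed_sets_def)
  then obtain s where s: "s \<in> S" "\<bar>s\<bar> = m" by (metis imageE insertI1)
  have "abs ` (S - {s}) = N"
    using S s assms by (auto simp: inj_on_image_set_diff[of abs S])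
  then have "S - {s} \<in> signed_sets N"
    using S by (auto simp: signed_sets_def inj_on_diff)
  moreover have "S = insert s (S - {s})" "s = m \<or> s = - m" using s by auto
  ultimately show "S \<in> insert m ` signed_sets N \<union> insert (- m) ` signed_sets N" by blast
next
  fix S assume "S \<in> insert m ` signed_sets N \<union> insert (- m) ` signed_sets N"
  then show "S \<in> signed_sets (insert m N)"
    using assms by (auto simp: signed_sets_def)
qed

lemma signed_sets_insert_notin:
  assumes "m > 0" "m \<notin> N" "S \<in> signed_sets N"
  shows "m \<notin> S" "- m \<notin> S"
  using assms by (force simp: signed_sets_def image_iff)+

lemma sum_signed_sets_insert:
  assumes "finite N" "m > 0" "m \<notin> N"
  shows "(\<Sum>S\<in>signed_sets (insert m N). f S) =
         (\<Sum>S\<in>signed_sets N. f (insert m S) + f (insert (- m) S))"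
proof -
  note ni = signed_sets_insert_notin[OF assms(2,3)]
  have inj: "inj_on (insert m) (signed_sets N)" "inj_on (insert (- m)) (signed_sets N)"
    using ni by (meson inj_onI insert_ident)+
  have disj: "insert m ` signed_sets N \<inter> insert (- m) ` signed_sets N = {}"
  proof -
    have "insert m S \<noteq> insert (- m) S'" if "S' \<in> signed_sets N" for S S'
      using ni(1)[OF that] assms(2) by (metis insert_iff equal_neg_zero less_irrefl)
    then show ?thesis by auto
  qed
  show ?thesis
    unfolding signed_sets_insert[OF assms(2,3)]
    using finite_signed_sets[OF assms(1)] disj
    by (simp add: sum.union_disjoint sum.reindex[OF inj(1)] sum.reindex[OF inj(2)] sum.distrib o_def)
qed

lemma card_signed_sets:
  assumes "finite N" "\<And>i. i \<in> N \<Longrightarrow> i > 0"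
  shows "card (signed_sets N) = 2 ^ card N"
  using assms
proof (induction N rule: finite_induct)
  case (insert m N)
  have "card (signed_sets (insert m N)) = (\<Sum>S\<in>signed_sets (insert m N). 1)" by simp
  also have "\<dots> = 2 * card (signed_sets N)"
    by (subst sum_signed_sets_insert) (use insert in auto)
  finally show ?case using insert by simp
qed (simp add: signed_sets_empty)

text \<open>The all-negative choice of signs is the only one whose maximum is not positive. This
  counts the possible last blocks of a word that ends in a positive letter.\<close>

lemma card_signed_sets_Max_pos:
  assumes "finite N" "N \<noteq> {}" "\<And>i. i \<in> N \<Longrightarrow> i > 0"
  shows "card {S \<in> signed_sets N. Max S > 0} = 2 ^ card N - 1"
proof -
  have "{S \<in> signed_sets N. Max S > 0} = signed_sets N - {uminus ` N}"
  proof (intro equalityI subsetI)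
    fix S assume "S \<in> {S \<in> signed_sets N. Max S > 0}"
    then have S: "S \<in> signed_sets N" "Max S > 0" by auto
    then have "finite S" "S \<noteq> {}" using assms by (auto simp: signed_sets_finite signed_sets_def)
    then have "Max S \<in> S" by simp
    then show "S \<in> signed_sets N - {uminus ` N}" using S assms by force
  next
    fix S assume "S \<in> signed_sets N - {uminus ` N}"
    then have S: "S \<in> signed_sets N" "S \<noteq> uminus ` N" by auto
    have fin: "finite S" "S \<noteq> {}" using S assms by (auto simp: signed_sets_finite signed_sets_def)
    have "\<exists>s\<in>S. s > 0"
    proof (rule ccontr)
      assume "\<not> ?thesis"
      then have *: "\<forall>s\<in>S. \<bar>s\<bar> = - s" by auto
      then have "uminus ` abs ` S = (\<lambda>s. s) ` S" unfolding image_image by (intro image_cong) auto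
      then show False using S by (auto simp: signed_sets_def)
    qed
    then show "S \<in> {S \<in> signed_sets N. Max S > 0}" using S fin by (auto simp: Max_gr_iff)
  qed
  moreover have "uminus ` N \<in> signed_sets N"
  proof -
    have "abs ` uminus ` N = (\<lambda>s. s) ` N"
      unfolding image_image using assms(3) by (intro image_cong) (auto simp: abs_of_pos)
    moreover have "inj_on abs (uminus ` N)" 
    proof (rule inj_onI)
      fix a b assume "a \<in> uminus ` N" "b \<in> uminus ` N" "\<bar>a\<bar> = \<bar>b\<bar>"
      then show "a = b" using assms(3)[of "- a"] assms(3)[of "- b"] by force
    qed
    ultimately show ?thesis by (simp add: signed_sets_def)
  qed
  ultimately show ?thesis using card_signed_sets[OF assms(1,3)] finite_signed_sets[OF assms(1)] by simp
qed

lemma finite_signed_words: 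
  assumes "finite N" shows "finite (signed_words N)"
proof -
  have "signed_words N \<subseteq> (\<Union>S\<in>signed_sets N. {l. set l \<subseteq> S \<and> length l \<le> card S})"
    by (auto simp: signed_words_def) (metis distinct_card order_refl)
  moreover have "finite \<dots>" using assms
    by (auto intro!: finite_signed_sets finite_lists_length_le signed_sets_finite)
  ultimately show ?thesis by (rule finite_subset)
qed

lemma word_des_Nil [simp]: "word_des [] = 0"
  by (simp add: word_des_def)

lemma word_des_snoc:
  "word_des (l @ [a]) = word_des l + (if last (0 # l) > a then 1 else 0)"
proof -
  have "(0 # l @ [a]) ! i = (0 # l) ! i" if "i \<le> length l" for i
    using that nth_append[of "0 # l" "[a]" i] by simp
  \<comment> \<open>For empty \<open>l\<close> the predecessor of \<open>a\<close> is the prefixed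
    0; \<open>last (0 # l)\<close> covers this case too.\<close>
  moreover have "(0 # l) ! length l = last (0 # l)"
    by (simp only: last_conv_nth list.distinct not_False_eq_True) simp
  ultimately have "{i. i < length (l @ [a]) \<and> (0 # l @ [a]) ! i > (l @ [a]) ! i} =
      {i. i < length l \<and> (0 # l) ! i > l ! i} \<union> {i. i = length l \<and> last (0 # l) > a}"
    by (intro Collect_eqI[THEN trans, OF _ Collect_disj_eq]) (auto simp: less_Suc_eq nth_append simp del: last.simps)
  moreover have "card \<dots> = word_des l + card {i. i = length l \<and> last (0 # l) > a}"
    by (subst card_Un_disjoint) (auto simp: word_des_def)
  ultimately show ?thesis by (simp add: word_des_def)
qed

section \<open>Block decomposition of signed words\<close>

lemma sorted_snoc:
  fixes a :: "'a :: linorder"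
  assumes "l \<noteq> []"
  shows "sorted_wrt (<) (l @ [a]) \<longleftrightarrow> sorted_wrt (<) l \<and> last l < a"
proof -
  obtain l' b where "l = l' @ [b]" using assms by (metis rev_exhaust)
  then show ?thesis by (auto simp: sorted_wrt_append intro: less_trans)
qed

text \<open>Each descent of a word must be cut and each ascent may be cut, with weights \<open>x\<close> for a
  cut and \<open>1 - x\<close> for an uncut ascent; the sum runs over the position of the last cut.\<close>

lemma power_word_des_split:
  fixes x :: "'b::comm_ring_1"
  assumes "distinct (0 # l)"
  shows "x ^ word_des l =
    (\<Sum>j | j < length l \<and> sorted_wrt (<) (drop j l).
        x * (1 - x) ^ (length l - j - 1) * x ^ word_des (take j l)) +
    (if sorted_wrt (<) (0 # l) then (1 - x) ^ length l else 0)"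
  using assms
\<comment> \<open>A last block of \<open>length l - j\<close> letters has one inner ascent fewer
  than letters. Without any cut the block begins at the prefixed 0, which brings the exponent up to
  \<open>length l\<close>.\<close>
proof (induction l rule: rev_induct)
  case (snoc a l)
  define b where "b \<longleftrightarrow> last (0 # l) < a"
  define J where "J = {j. j < length l \<and> sorted_wrt (<) (drop j l)}"
  let ?g = "\<lambda>l j. x * (1 - x) ^ (length l - j - 1) * x ^ word_des (take j l)"
  have fin: "finite J" by (auto simp: J_def)
  have b': "\<not> b \<longleftrightarrow> last (0 # l) > a"
  proof -
    have "last (0 # l) \<noteq> a" using snoc.prems last_in_set[of "0 # l"] by auto
    then show ?thesis by (auto simp: b_def)
  qed
  \<comment> \<open>The last cut may lie directly before \<open>a\<close>. It can lie earlier only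
    if the step to \<open>a\<close> is an ascent; this ascent is then uncut and contributes the
    factor \<open>1 - x\<close>.\<close>
  have set: "{j. j < length (l @ [a]) \<and> sorted_wrt (<) (drop j (l @ [a]))} =
      insert (length l) (if b then J else {})"
  proof -
    have "sorted_wrt (<) (drop j (l @ [a])) \<longleftrightarrow> sorted_wrt (<) (drop j l) \<and> b" if "j < length l" for j
      using that by (auto simp: sorted_snoc b_def)
    then show ?thesis by (auto simp: J_def less_Suc_eq)
  qed
  have g: "?g (l @ [a]) j = (1 - x) * ?g l j" if "j \<in> J" for j
  proof -
    have "length (l @ [a]) - j - 1 = Suc (length l - j - 1)" using that by (auto simp: J_def)
    then show ?thesis using that by (simp add: J_def algebra_simps)
  qed
  have "length l \<notin> J" by (simp add: J_def)
  then have "(\<Sum>j | j < length (l @ [a]) \<and> sorted_wrt (<) (drop j (l @ [a])). ?g (l @ [a]) j) =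
      x * x ^ word_des l + (if b then (1 - x) * (\<Sum>j\<in>J. ?g l j) else 0)"
    unfolding set using fin g by (simp add: sum_distrib_left)
  moreover have "sorted_wrt (<) (0 # l @ [a]) \<longleftrightarrow> sorted_wrt (<) (0 # l) \<and> b"
    using sorted_snoc[of "0 # l" a] by (simp add: b_def)
  moreover have "x ^ word_des l = (\<Sum>j\<in>J. ?g l j) + (if sorted_wrt (<) (0 # l) then (1 - x) ^ length l else 0)"
    using snoc by (simp add: J_def)
  \<comment> \<open>At an ascent the weights \<open>x\<close> and \<open>1 - x\<close> add up to 1,
    so the power is unchanged; at a descent only the cut with weight \<open>x\<close>
    remains.\<close>
  ultimately show ?case
    using b' by (simp add: word_des_snoc algebra_simps split: if_splits)
qed simp

lemma signed_words_append:
  assumes N: "finite N" "M \<subseteq> N" and l: "l \<in> signed_words M" and U: "U \<in> signed_sets (N - M)"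
  shows "l @ sorted_list_of_set U \<in> signed_words N"
proof -
  have fU: "finite U" using U N signed_sets_finite by blast
  have l': "distinct l" "abs ` set l = M" "inj_on abs (set l)"
    using l by (auto simp: signed_words_def signed_sets_def)
  have U': "abs ` U = N - M" "inj_on abs U" using U by (auto simp: signed_sets_def)
  have "set l \<inter> U = {}" using l' U' by blast
  moreover have "inj_on abs (set l \<union> U)" 
    unfolding inj_on_Un using l' U' by blast
  moreover have "abs ` (set l \<union> U) = N" using l' U' N by (auto simp: image_Un)
  ultimately show ?thesis using l' fU by (auto simp: signed_words_def signed_sets_def)
qed

lemma signed_words_take_drop:
  assumes l: "l \<in> signed_words N"
  shows "take j l \<in> signed_words (abs ` set (take j l))"
    and "set (drop j l) \<in> signed_sets (N - abs ` set (take j l))"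
    and "abs ` set (take j l) \<subseteq> N"
proof -
  have l': "distinct l" "abs ` set l = N" "inj_on abs (set l)"
    using l by (auto simp: signed_words_def signed_sets_def)
  have un: "set l = set (take j l) \<union> set (drop j l)" by (metis append_take_drop_id set_append)
  have disj: "set (take j l) \<inter> set (drop j l) = {}"
    using l'(1) by (metis append_take_drop_id distinct_append)
  have inj: "inj_on abs (set (take j l))" "inj_on abs (set (drop j l))"
    using l'(3) set_take_subset set_drop_subset by (metis inj_on_subset)+
  show "take j l \<in> signed_words (abs ` set (take j l))"
    using l' inj by (auto simp: signed_words_def signed_sets_def)
  show "abs ` set (take j l) \<subseteq> N" using l'(2) un by auto
  have "abs ` set (drop j l) = N - abs ` set (take j l)"
    using l'(2,3) un disj inj_on_image_set_diff[of abs "set l" "set l" "set (take j l)"] by auto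
  then show "set (drop j l) \<in> signed_sets (N - abs ` set (take j l))"
    using inj by (simp add: signed_sets_def)
qed

lemma length_signed_words: "l \<in> signed_words N \<Longrightarrow> length l = card N"
  using signed_sets_card distinct_card by (fastforce simp: signed_words_def)

text \<open>An increasing suffix is determined by its set of letters, so cutting a word before such
  a suffix amounts to choosing the set \<open>M\<close> of absolute values of the prefix, a signed
  word on \<open>M\<close> and a signed set on \<open>N - M\<close>. The suffix is nonempty, hence
  \<open>M\<close> differs from \<open>N\<close>.\<close>

lemma sum_signed_words_split:
  fixes g :: "int list \<Rightarrow> int set \<Rightarrow> 'b::comm_ring_1"
  assumes N: "finite N"
  shows "(\<Sum>l\<in>signed_words N. \<Sum>j | j < length l \<and> sorted_wrt (<) (drop j l). g (take j l) (set (drop j l))) =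
    (\<Sum>M\<in>Pow N - {N}. \<Sum>l\<in>signed_words M. \<Sum>U\<in>signed_sets (N - M). g l U)"
proof -
  have fin: "finite M" if "M \<in> Pow N - {N}" for M using that N finite_subset by blast
  have fU: "finite U" if "U \<in> signed_sets (N - M)" for U M using that N signed_sets_finite by blast
  have "(\<Sum>l\<in>signed_words N. \<Sum>j | j < length l \<and> sorted_wrt (<) (drop j l). g (take j l) (set (drop j l))) =
     (\<Sum>(l, j)\<in>(SIGMA l:signed_words N. {j. j < length l \<and> sorted_wrt (<) (drop j l)}). g (take j l) (set (drop j l)))"
    using N by (intro sum.Sigma) (auto simp: finite_signed_words)
  also have "\<dots> = (\<Sum>(M, l, U)\<in>(SIGMA M:Pow N - {N}. SIGMA l:signed_words M. signed_sets (N - M)). g l U)"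
  proof (rule sum.reindex_bij_witness[where
      i = "\<lambda>(M, l, U). (l @ sorted_list_of_set U, length l)" and
      j = "\<lambda>(l, j). (abs ` set (take j l), take j l, set (drop j l))"], goal_cases)
    case (1 a)
    then show ?case
      by (auto simp: strict_sorted_equal sorted_list_of_set.idem_if_sorted_distinct 
        strict_sorted_iff)
  next
    case (2 a)
    obtain l j where a: "a = (l, j)" "l \<in> signed_words N" "j < length l" "sorted_wrt (<) (drop j l)"
      using 2 by auto
    have "abs ` set (drop j l) = N - abs ` set (take j l)"
      using signed_words_take_drop(2)[OF a(2), of j] by (simp add: signed_sets_def)
    moreover have "abs ` set (drop j l) \<noteq> {}" using a by simp
    ultimately have "N - abs ` set (take j l) \<noteq> {}" by metis
    then show ?case using a signed_words_take_drop[OF a(2), of j] by auto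
  next
    case (3 b)
    then show ?case using fU by (auto simp: signed_words_def signed_sets_def)
  next
    case (4 b)
    obtain M l U where b: "b = (M, l, U)" "M \<subseteq> N" "M \<noteq> N" "l \<in> signed_words M" "U \<in> signed_sets (N - M)"
      using 4 by auto
    have "U \<noteq> {}" using b by (auto simp: signed_sets_def)
    then have "U \<noteq> {} \<and> finite U" using fU b by auto
    then show ?case using b signed_words_append[OF N b(2,4,5)] 
      by (auto simp: strict_sorted_list_of_set card_gt_0_iff)
  next
    case (5 a)
    then show ?case by auto
  qed
  also have "\<dots> = (\<Sum>M\<in>Pow N - {N}. \<Sum>(l, U)\<in>(SIGMA l:signed_words M. signed_sets (N - M)). g l U)"
    using N fin by (subst sum.Sigma) (auto simp: finite_signed_words finite_signed_sets)
  also have "\<dots> = (\<Sum>M\<in>Pow N - {N}. \<Sum>l\<in>signed_words M. \<Sum>U\<in>signed_sets (N - M). g l U)"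
    using N fin by (intro sum.cong refl sum.Sigma[symmetric]) (auto simp: finite_signed_words finite_signed_sets)
  finally show ?thesis .
qed

text \<open>Increasing from 0 forces every letter to be positive, which leaves one word. It is the
  word that can stay entirely uncut.\<close>

lemma sum_signed_words_sorted:
  fixes f :: "int list \<Rightarrow> 'b::comm_ring_1"
  assumes N: "finite N" "\<And>i. i \<in> N \<Longrightarrow> i > 0"
  shows "(\<Sum>l\<in>signed_words N. if sorted_wrt (<) (0 # l) then f l else 0) = f (sorted_list_of_set N)"
proof -
  have "{l \<in> signed_words N. sorted_wrt (<) (0 # l)} = {sorted_list_of_set N}"
  proof (intro equalityI subsetI)
    fix l assume "l \<in> {l \<in> signed_words N. sorted_wrt (<) (0 # l)}"
    then have l: "abs ` set l = N" "sorted_wrt (<) l" "\<forall>s\<in>set l. s > 0"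
      by (auto simp: signed_words_def signed_sets_def)
    have "abs ` set l = (\<lambda>s. s) ` set l" using l(3) by (intro image_cong) auto
    then have "set l = N" using l(1) by simp
    then have "l = sorted_list_of_set N"
      using l(2) by (metis sorted_list_of_set.idem_if_sorted_distinct strict_sorted_iff)
    then show "l \<in> {sorted_list_of_set N}" by simp
  next
    fix l assume "l \<in> {sorted_list_of_set N}"
    moreover have "abs ` N = (\<lambda>s. s) ` N" using N(2) by (intro image_cong) (auto simp: abs_of_pos)
    moreover have "inj_on abs N"
    proof (rule inj_onI)
      fix a b assume "a \<in> N" "b \<in> N" "\<bar>a\<bar> = \<bar>b\<bar>"
      then show "a = b" using N(2)[of a] N(2)[of b] by simp
    qed
    ultimately show "l \<in> {l \<in> signed_words N. sorted_wrt (<) (0 # l)}" using N 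
      by (auto simp: signed_words_def signed_sets_def)
  qed
  then show ?thesis using finite_signed_words[OF N(1)] by (simp flip: sum.inter_filter)
qed

lemma Max_strict_sorted:
  fixes l :: "'a::linorder list"
  assumes "sorted_wrt (<) l" "l \<noteq> []"
  shows "Max (set l) = last l"
proof -
  obtain l' b where l: "l = l' @ [b]" using assms by (metis rev_exhaust)
  show ?thesis using assms unfolding l
    by (intro Max_eqI) (auto simp: sorted_wrt_append less_imp_le)
qed

text \<open>The last letter is the maximum of the last block, so a weight on it passes to that block
  alone, while the prefix stays unrestricted. Constant \<open>\<phi>\<close> yields the recursion of
  \<open>eB\<close>, the indicator of positive numbers that of \<open>Bplus\<close>. The final
  summand is the uncut word.\<close>

lemma sum_power_word_des:
  fixes x :: "'b::comm_ring_1"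
  assumes N: "finite N" "\<And>i. i \<in> N \<Longrightarrow> i > 0" "N \<noteq> {}"
  shows "(\<Sum>l\<in>signed_words N. \<phi> (last l) * x ^ word_des l) =
    (\<Sum>M\<in>Pow N - {N}. (\<Sum>U\<in>signed_sets (N - M). \<phi> (Max U)) *
      (x * (1 - x) ^ (card N - card M - 1) * (\<Sum>l\<in>signed_words M. x ^ word_des l))) +
    \<phi> (Max N) * (1 - x) ^ card N"
proof -
  define g where "g l U = \<phi> (Max U) * (x * (1 - x) ^ (card U - 1) * x ^ word_des l)" for l and U :: "int set"
  have 1: "\<phi> (last l) * x ^ word_des l =
     (\<Sum>j | j < length l \<and> sorted_wrt (<) (drop j l). g (take j l) (set (drop j l))) +
     (if sorted_wrt (<) (0 # l) then \<phi> (last l) * (1 - x) ^ card N else 0)" if l: "l \<in> signed_words N" for l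
  proof -
    have d: "distinct (0 # l)" using l N(2) by (force simp: signed_words_def signed_sets_def)
    have len: "length l = card N" using l by (rule length_signed_words)
    have "g (take j l) (set (drop j l)) = \<phi> (last l) * (x * (1 - x) ^ (length l - j - 1) * x ^ word_des (take j l))"
      if "j < length l" "sorted_wrt (<) (drop j l)" for j
    proof -
      have "Max (set (drop j l)) = last (drop j l)"
        using that by (intro Max_strict_sorted) auto
      moreover have "card (set (drop j l)) = length l - j" using d by (simp add: distinct_card)
      ultimately show ?thesis using that by (simp add: g_def)
    qed
    then show ?thesis
      by (subst power_word_des_split[OF d]) (simp add: ring_distribs sum_distrib_left len)
  qed
  have last: "last (sorted_list_of_set N) = Max N"
    using N(1,3) Max_strict_sorted[of "sorted_list_of_set N"] by (simp add: strict_sorted_list_of_set)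
  have "(\<Sum>l\<in>signed_words N. \<phi> (last l) * x ^ word_des l) =
      (\<Sum>M\<in>Pow N - {N}. \<Sum>l\<in>signed_words M. \<Sum>U\<in>signed_sets (N - M). g l U) +
      \<phi> (Max N) * (1 - x) ^ card N"
    by (simp add: 1 sum.distrib sum_signed_words_split[OF N(1)] sum_signed_words_sorted[OF N(1,2)] last
        del: sorted_wrt.simps)
  also have "(\<Sum>M\<in>Pow N - {N}. \<Sum>l\<in>signed_words M. \<Sum>U\<in>signed_sets (N - M). g l U) =
    (\<Sum>M\<in>Pow N - {N}. (\<Sum>U\<in>signed_sets (N - M). \<phi> (Max U)) *
      (x * (1 - x) ^ (card N - card M - 1) * (\<Sum>l\<in>signed_words M. x ^ word_des l)))"
  proof (rule sum.cong[OF refl])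
    fix M assume M: "M \<in> Pow N - {N}"
    have "(\<Sum>l\<in>signed_words M. \<Sum>U\<in>signed_sets (N - M). g l U) =
      (\<Sum>U\<in>signed_sets (N - M). \<Sum>l\<in>signed_words M. g l U)" by (rule sum.swap)
    also have "\<dots> = (\<Sum>U\<in>signed_sets (N - M). \<phi> (Max U) * (x * (1 - x) ^ (card N - card M - 1) * (\<Sum>l\<in>signed_words M. x ^ word_des l)))"
    proof (rule sum.cong[OF refl])
      fix U assume "U \<in> signed_sets (N - M)"
      then have "card U = card N - card M"
        using M N(1) by (auto simp: signed_sets_card card_Diff_subset finite_subset)
      then show "(\<Sum>l\<in>signed_words M. g l U) = \<phi> (Max U) * (x * (1 - x) ^ (card N - card M - 1) * (\<Sum>l\<in>signed_words M. x ^ word_des l))"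
        by (simp add: g_def sum_distrib_left mult.assoc)
    qed
    finally show "(\<Sum>l\<in>signed_words M. \<Sum>U\<in>signed_sets (N - M). g l U) =
      (\<Sum>U\<in>signed_sets (N - M). \<phi> (Max U)) * (x * (1 - x) ^ (card N - card M - 1) * (\<Sum>l\<in>signed_words M. x ^ word_des l))"
      by (simp add: sum_distrib_right)
  qed
  finally show ?thesis .
qed

lemma signed_words_empty: "signed_words {} = {[]}"
  by (auto simp: signed_words_def signed_sets_def)

lemma sum_word_des_eB:
  assumes "finite N" "\<And>i. i \<in> N \<Longrightarrow> i > 0"
  shows "(\<Sum>l\<in>signed_words N. [:0, 1:] ^ word_des l) = eB (card N)"
  using assms
proof (induction "card N" arbitrary: N rule: less_induct)
  case less
  show ?case
  proof (cases "N = {}")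
    case True
    then show ?thesis by (simp add: signed_words_empty eB.simps[of 0])
  next
    case False
    have y: "(1 - [:0, 1:] :: real poly) = [:1, -1:]" by (simp add: one_pCons)
    have "(\<Sum>l\<in>signed_words N. [:0, 1:] ^ word_des l) = 
      (\<Sum>M\<in>Pow N - {N}. (2 ^ (card N - card M) *
      ([:0, 1:] * [:1, -1:] ^ (card N - card M - 1) * eB (card M)))) + [:1, -1:] ^ card N"
    proof -
      have "(\<Sum>U\<in>signed_sets (N - M). 1) *
         ([:0, 1:] * [:1, -1:] ^ (card N - card M - 1) * (\<Sum>l\<in>signed_words M. [:0, 1:] ^ word_des l)) =
         2 ^ (card N - card M) * ([:0, 1:] * [:1, -1:] ^ (card N - card M - 1) * eB (card M))"
        if M: "M \<in> Pow N - {N}" for M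
      proof -
        have "finite M" "card M < card N" using M less.prems(1) by (auto intro: finite_subset psubset_card_mono)
        moreover have "card (signed_sets (N - M)) = 2 ^ (card N - card M)"
          using M less.prems by (subst card_signed_sets) (auto simp: card_Diff_subset finite_subset)
        moreover have "(\<Sum>l\<in>signed_words M. [:0, 1:] ^ word_des l) = eB (card M)"
          using calculation less M by auto
        ultimately show ?thesis by simp
      qed
      then show ?thesis
        using sum_power_word_des[OF less.prems False, where \<phi> = "\<lambda>_. 1" and x = "[:0, 1:] :: real poly", unfolded y]
        by (simp only: mult_1 cong: sum.cong)
    qed
    also have "\<dots> = eB (card N)"
      unfolding eB.simps[of "card N"]
      by (subst sum_proper_subsets_by_card[OF less.prems(1)]) (simp add: mult.assoc add.commute)
    finally show ?thesis .
  qed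
qed

text \<open>Of the \<open>2 ^ (card N - k)\<close> signed last blocks on a given set of absolute
  values, one has a negative maximum and is excluded. The letters before the last block may have any
  sign at their end, so the sum contains \<open>eB k\<close> and not \<open>Bplus k\<close>.\<close>

lemma sum_word_des_last_pos:
  assumes "finite N" "\<And>i. i \<in> N \<Longrightarrow> i > 0" "N \<noteq> {}"
  shows "(\<Sum>l\<in>{l \<in> signed_words N. last l > 0}. [:0, 1:] ^ word_des l) =
    (\<Sum>k<card N. of_nat (card N choose k) * ((2 ^ (card N - k) - 1) *
     ([:0, 1:] * [:1, -1:] ^ (card N - k - 1) * eB k))) + [:1, -1:] ^ card N"
proof -
  let ?\<phi> = "\<lambda>a::int. if a > 0 then 1 else 0 :: real poly"
  have y: "(1 - [:0, 1:] :: real poly) = [:1, -1:]" by (simp add: one_pCons)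
  have m: "Max N > 0" using assms by simp
  have "(\<Sum>U\<in>signed_sets (N - M). ?\<phi> (Max U)) *
         ([:0, 1:] * [:1, -1:] ^ (card N - card M - 1) * (\<Sum>l\<in>signed_words M. [:0, 1:] ^ word_des l)) =
         (2 ^ (card N - card M) - 1) * ([:0, 1:] * [:1, -1:] ^ (card N - card M - 1) * eB (card M))"
        if M: "M \<in> Pow N - {N}" for M
  proof -
    have "finite M" using M assms(1) by (auto intro: finite_subset)
    have "(\<Sum>U\<in>signed_sets (N - M). ?\<phi> (Max U)) = of_nat (card {U \<in> signed_sets (N - M). Max U > 0})"
      using assms(1) by (simp add: finite_signed_sets flip: sum.inter_filter)
    also have "\<dots> = 2 ^ (card N - card M) - 1"
      using M assms \<open>finite M\<close>
      by (subst card_signed_sets_Max_pos) (auto simp: card_Diff_subset of_nat_diff)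
    moreover have "(\<Sum>l\<in>signed_words M. [:0, 1:] ^ word_des l) = eB (card M)"
      using assms M \<open>finite M\<close> by (intro sum_word_des_eB) auto
    ultimately show ?thesis by simp
  qed
  moreover have "(\<Sum>l\<in>{l \<in> signed_words N. last l > 0}. [:0, 1:] ^ word_des l) = 
    (\<Sum>l\<in>signed_words N. ?\<phi> (last l) * [:0, 1:] ^ word_des l)"
    using assms(1) by (simp add: finite_signed_words sum.inter_filter if_distrib cong: if_cong)
       (rule sum.cong, auto)
  ultimately have "(\<Sum>l\<in>{l \<in> signed_words N. last l > 0}. [:0, 1:] ^ word_des l) =
    (\<Sum>M\<in>Pow N - {N}. (2 ^ (card N - card M) - 1) *
       ([:0, 1:] * [:1, -1:] ^ (card N - card M - 1) * eB (card M))) + ?\<phi> (Max N) * [:1, -1:] ^ card N"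
    by (simp only: sum_power_word_des[OF assms, where \<phi> = ?\<phi> and x = "[:0, 1:] :: real poly", unfolded y]
       cong: sum.cong)
  also have "(\<Sum>M\<in>Pow N - {N}. (2 ^ (card N - card M) - 1) *
       ([:0, 1:] * [:1, -1:] ^ (card N - card M - 1) * eB (card M))) = (\<Sum>k<card N. of_nat (card N choose k) * ((2 ^ (card N - k) - 1) *
     ([:0, 1:] * [:1, -1:] ^ (card N - k - 1) * eB k)))"
    by (rule sum_proper_subsets_by_card[OF assms(1)])
  finally show ?thesis using m by simp
qed

section \<open>Signed permutations as words\<close>

lemma sa_signed_sets:
  assumes S: "S \<in> signed_sets {1..int n}"
  shows "i \<in> {1..n} \<Longrightarrow> sa S i \<in> S" and "s \<in> S \<Longrightarrow> sa S (nat \<bar>s\<bar>) = s"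
    and "s \<in> S \<Longrightarrow> nat \<bar>s\<bar> \<in> {1..n}" and "nat \<bar>sa S i\<bar> = i"
proof -
  have im: "abs ` S = {1..int n}" and inj: "inj_on abs S" using S by (auto simp: signed_sets_def)
  show "sa S i \<in> S" if "i \<in> {1..n}"
  proof -
    have "int i \<in> abs ` S" using that im by auto
    then obtain s where "s \<in> S" "int i = \<bar>s\<bar>" by auto
    then have "s = int i \<or> s = - int i" by linarith
    then show ?thesis using \<open>s \<in> S\<close> by (auto simp: sa_def)
  qed
  show "nat \<bar>s\<bar> \<in> {1..n}" if "s \<in> S"
  proof -
    have "\<bar>s\<bar> \<in> {1..int n}" using that im by blast
    then show ?thesis by auto
  qed
  show "sa S (nat \<bar>s\<bar>) = s" if "s \<in> S"
  proof -
    have "\<bar>s\<bar> = s" if "\<bar>s\<bar> \<in> S"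
      using inj_onD[OF inj, of "\<bar>s\<bar>" s] \<open>s \<in> S\<close> that by simp
    then show ?thesis using that by (cases "s \<ge> 0") (auto simp: sa_def)
  qed
  show "nat \<bar>sa S i\<bar> = i" by (simp add: sa_def)
qed

text \<open>The normalisation of \<open>w\<close> outside \<open>S\<close> is what
  \<open>permutes\<close> demands, so sums split into a choice of signs and a permutation of a fixed
  set.\<close>

lemma signed_perms_eq:
  "signed_perms n = (SIGMA S:signed_sets {1..int n}. {w. w permutes S})"
proof -
  have "(\<exists>a :: nat \<Rightarrow> int. (\<forall>i\<in>{1..n}. a i = int i \<or> a i = - int i) \<and> S = a ` {1..n})
      \<longleftrightarrow> S \<in> signed_sets {1..int n}" (is "?L \<longleftrightarrow> ?R") for S
  proof
    assume ?L
    then obtain a where a: "\<forall>i\<in>{1..n}. a i = int i \<or> a i = - int i" "S = a ` {1..n}" by blast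
    have ab: "\<bar>a i\<bar> = int i" if "i \<in> {1..n}" for i using a(1) that by force
    have "abs ` S = int ` {1..n}" unfolding a(2) image_image using ab by (rule image_cong[OF refl])
    moreover have "inj_on abs S" unfolding a(2) using ab by (auto intro!: inj_onI)
    ultimately show ?R by (simp add: signed_sets_def image_int_atLeastAtMost)
  next
    assume ?R
    note sa = sa_signed_sets[OF this]
    have "S = sa S ` {1..n}"
    proof (intro equalityI subsetI)
      fix s assume "s \<in> S"
      then show "s \<in> sa S ` {1..n}" using sa(2,3)[of s] by (metis image_eqI)
    qed (use sa(1) in auto)
    then show ?L by (intro exI[of _ "sa S"]) (auto simp: sa_def)
  qed
  moreover have "bij_betw w S S \<and> (\<forall>x. x \<notin> S \<longrightarrow> w x = x) \<longleftrightarrow> w permutes S" for S and w :: "int \<Rightarrow> int"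
    by (auto intro: bij_imp_permutes permutes_imp_bij permutes_not_in)
  ultimately show ?thesis unfolding signed_perms_def by blast
qed

definition perm_word :: "nat \<Rightarrow> int set \<times> (int \<Rightarrow> int) \<Rightarrow> int list" where
  "perm_word n p = map (\<lambda>i. snd p (sa (fst p) (Suc i))) [0..<n]"

lemma set_perm_word:
  assumes "S \<in> signed_sets {1..int n}" "w permutes S"
  shows "set (perm_word n (S, w)) = S"
proof -
  note sa = sa_signed_sets[OF assms(1)]
  have "sa S ` {1..n} = S"
  proof (intro equalityI subsetI)
    fix s assume "s \<in> S"
    then show "s \<in> sa S ` {1..n}" using sa(2,3)[of s] by (metis image_eqI)
  qed (use sa(1) in auto)
  moreover have "set (perm_word n (S, w)) = w ` sa S ` {1..n}"
  proof -
    have "{1..n} = Suc ` {0..<n}" by auto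
    then show ?thesis by (simp only: perm_word_def image_image set_map set_upt fst_conv snd_conv)
  qed
  ultimately show ?thesis using assms(2) by (simp add: permutes_image)
qed

lemma perm_word_in_signed_words:
  assumes "S \<in> signed_sets {1..int n}" "w permutes S"
  shows "perm_word n (S, w) \<in> signed_words {1..int n}"
proof -
  have "card (set (perm_word n (S, w))) = length (perm_word n (S, w))"
    using signed_sets_card[OF assms(1)] by (simp add: set_perm_word[OF assms]) (simp add: perm_word_def)
  then show ?thesis using assms(1) by (simp add: signed_words_def set_perm_word[OF assms] card_distinct)
qed

text \<open>The letters of the word form \<open>S\<close> itself, because \<open>w\<close> maps
  \<open>S\<close> onto \<open>S\<close>. The value at \<open>x\<close> is then the letter at place
  \<open>\<bar>x\<bar>\<close>, that is, at list index \<open>nat \<bar>x\<bar> - 1\<close>.\<close>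

lemma bij_betw_perm_word:
  "bij_betw (perm_word n) (signed_perms n) (signed_words {1..int n})"
proof (rule bij_betw_byWitness[where f' = "\<lambda>l. (set l, \<lambda>x. if x \<in> set l then l ! (nat \<bar>x\<bar> - 1) else x)"])
  show "\<forall>p\<in>signed_perms n. (set (perm_word n p), \<lambda>x. if x \<in> set (perm_word n p) then perm_word n p ! (nat \<bar>x\<bar> - 1) else x) = p"
  proof
    fix p assume "p \<in> signed_perms n"
    then obtain S w where p: "p = (S, w)" "S \<in> signed_sets {1..int n}" "w permutes S"
      by (auto simp: signed_perms_eq)
    note sa = sa_signed_sets[OF p(2)]
    have "(if x \<in> S then perm_word n p ! (nat \<bar>x\<bar> - 1) else x) = w x" for x
    proof (cases "x \<in> S")
      case True
      then have "nat \<bar>x\<bar> \<in> {1..n}" using sa(3) by blast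
      then have "nat \<bar>x\<bar> - 1 < n" "Suc (nat \<bar>x\<bar> - 1) = nat \<bar>x\<bar>" by auto
      then show ?thesis using True sa(2) by (simp add: perm_word_def p(1))
    next
      case False
      then show ?thesis using p(3) by (simp add: permutes_not_in)
    qed
    then show "(set (perm_word n p), \<lambda>x. if x \<in> set (perm_word n p) then perm_word n p ! (nat \<bar>x\<bar> - 1) else x) = p"
      using p(1) by (simp add: set_perm_word[OF p(2,3)])
  qed
next
  show "perm_word n ` signed_perms n \<subseteq> signed_words {1..int n}"
    using perm_word_in_signed_words by (auto simp: signed_perms_eq)
next
  define u where "u l x = (if x \<in> set l then l ! (nat \<bar>x\<bar> - 1) else x)" for l :: "int list" and x :: int
  have u: "perm_word n (set l, u l) = l \<and> (set l, u l) \<in> signed_perms n" if l: "l \<in> signed_words {1..int n}" for l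
  proof -
    have S: "set l \<in> signed_sets {1..int n}" "distinct l" using l by (auto simp: signed_words_def)
    note sa = sa_signed_sets[OF S(1)]
    have len: "length l = n" using length_signed_words[OF l] by simp
    have eq: "perm_word n (set l, u l) = l"
    proof (rule nth_equalityI)
      fix i assume "i < length (perm_word n (set l, u l))"
      then have i: "i < n" by (simp add: perm_word_def)
      then have "sa (set l) (Suc i) \<in> set l" by (intro sa(1)) auto
      then show "perm_word n (set l, u l) ! i = l ! i"
        using i sa(4)[of "Suc i"] by (simp add: perm_word_def u_def)
    qed (simp add: perm_word_def len)
    have "u l permutes set l"
    proof (rule bij_imp_permutes)
      have sub: "u l ` set l \<subseteq> set l"
        using sa(3) len by (fastforce simp: u_def)
      have "set l \<subseteq> u l ` set l"
      proof
        fix y assume "y \<in> set l"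
        then obtain i where i: "i < n" "y = l ! i" using len by (auto simp: in_set_conv_nth)
        have "sa (set l) (Suc i) \<in> set l" using i by (intro sa(1)) auto
        moreover have "u l (sa (set l) (Suc i)) = y"
          using i calculation sa(4)[of "Suc i"] by (simp add: u_def)
        ultimately show "y \<in> u l ` set l" by force
      qed
      then have "u l ` set l = set l" using sub by blast
      then show "bij_betw (u l) (set l) (set l)"
        by (simp add: bij_betw_def eq_card_imp_inj_on)
    qed (simp add: u_def)
    then show ?thesis using eq S(1) by (simp add: signed_perms_eq)
  qed
  show "\<forall>l\<in>signed_words {1..int n}. perm_word n (set l, \<lambda>x. if x \<in> set l then l ! (nat \<bar>x\<bar> - 1) else x) = l"
    using u unfolding u_def by blast
  show "(\<lambda>l. (set l, \<lambda>x. if x \<in> set l then l ! (nat \<bar>x\<bar> - 1) else x)) ` signed_words {1..int n} \<subseteq> signed_perms n"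
    using u unfolding u_def by blast
qed

lemma finite_signed_perms: "finite (signed_perms n)"
  using bij_betw_finite[OF bij_betw_perm_word] finite_signed_words by blast

lemma desB_perm_word: "desB n (fst p) (snd p) = word_des (perm_word n p)"
proof -
  have "(0 # perm_word n p) ! i = wval (fst p) (snd p) i" if "i < n" for i
    using that by (cases i) (auto simp: perm_word_def wval_def)
  moreover have "perm_word n p ! i = wval (fst p) (snd p) (Suc i)" if "i < n" for i
    using that by (simp add: perm_word_def wval_def)
  ultimately have "{i \<in> {0..<n}. wval (fst p) (snd p) i > wval (fst p) (snd p) (Suc i)} =
      {i. i < length (perm_word n p) \<and> (0 # perm_word n p) ! i > perm_word n p ! i}"
    by (auto simp: perm_word_def)
  then show ?thesis by (simp add: desB_def word_des_def)
qed

lemma last_perm_word: "n > 0 \<Longrightarrow> last (perm_word n p) = snd p (sa (fst p) n)"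
  by (simp add: perm_word_def last_map)

lemma sum_signed_perms_des:
  assumes "n > 0"
  shows "(\<Sum>p\<in>{p \<in> signed_perms n. P (snd p (sa (fst p) n))}. monom 1 (desB n (fst p) (snd p))) =
    (\<Sum>l\<in>{l \<in> signed_words {1..int n}. P (last l)}. [:0, 1:] ^ word_des l :: real poly)"
proof -
  have "bij_betw (perm_word n) {p \<in> signed_perms n. P (snd p (sa (fst p) n))} {l \<in> signed_words {1..int n}. P (last l)}"
  proof -
    have "perm_word n ` {p \<in> signed_perms n. P (snd p (sa (fst p) n))} =
        {l \<in> perm_word n ` signed_perms n. P (last l)}"
      using last_perm_word[OF assms] by auto
    then show ?thesis using bij_betw_perm_word[of n] by (auto simp: bij_betw_def intro: inj_on_subset)
  qed
  then show ?thesis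
    using sum.reindex_bij_betw[of "perm_word n" _ _ "\<lambda>l. [:0, 1:] ^ word_des l :: real poly"]
    by (simp add: desB_perm_word monom_altdef)
qed

lemma Bplus_rec:
  "Bplus n = [:1, -1:] ^ n + (\<Sum>k<n. of_nat (n choose k) * ((2 ^ (n - k) - 1) *
     ([:0, 1:] * [:1, -1:] ^ (n - k - 1) * eB k)))"
proof (cases "n = 0")
  case False
  then show ?thesis
    using sum_word_des_last_pos[of "{1..int n}"] sum_signed_perms_des[of n "\<lambda>a. a > 0"]
    by (simp add: Bplus_def add.commute)
qed (simp add: Bplus_def)

lemma Bplus_plus_Bminus: "Bplus n + Bminus n = eB n"
proof (cases "n = 0")
  case True
  then show ?thesis by (simp add: Bplus_def Bminus_def eB.simps[of 0])
next
  case False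
  have "last l \<noteq> 0" if "l \<in> signed_words {1..int n}" for l
  proof -
    have "last l \<in> set l" using False length_signed_words[OF that] by auto
    then have "\<bar>last l\<bar> \<in> {1..int n}" using that by (auto simp: signed_words_def signed_sets_def)
    then show ?thesis by auto
  qed
  then have "(\<Sum>l\<in>signed_words {1..int n}. [:0, 1:] ^ word_des l) =
      (\<Sum>l\<in>{l \<in> signed_words {1..int n}. last l > 0} \<union> {l \<in> signed_words {1..int n}. last l < 0}.
        [:0, 1:] ^ word_des l)"
    by (intro sum.cong refl) (auto simp: neq_iff)
  also have "\<dots> = Bplus n + Bminus n"
    using False sum_signed_perms_des[of n "\<lambda>a. a > 0"] sum_signed_perms_des[of n "\<lambda>a. a < 0"]
       finite_signed_words[of "{1..int n}"]
    by (subst sum.union_disjoint) (auto simp: Bplus_def Bminus_def)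
  finally have "(\<Sum>l\<in>signed_words {1..int n}. [:0, 1:] ^ word_des l) = Bplus n + Bminus n" .
  then show ?thesis using sum_word_des_eB[of "{1..int n}"] by simp
qed

section \<open>Excedances and derangements\<close>

definition exc_set :: "int set \<Rightarrow> (int \<Rightarrow> int) \<Rightarrow> int set" where
  "exc_set S w = {a \<in> S. w a > a \<or> (a < 0 \<and> w a = a)}"

lemma excB_eq_card: "excB S w = card (exc_set S w)"
  by (simp add: excB_def exc_set_def)

lemma exc_set_subset: "exc_set S w \<subseteq> S"
  by (auto simp: exc_set_def)

section \<open>Insertion of an extreme letter into a permutation\<close>

lemma excB_insert_fixed:
  assumes "finite S" "m \<notin> S" "q permutes S"
  shows "excB (insert m S) q = excB S q + (if m < 0 then 1 else 0)"
proof -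
  have "exc_set (insert m S) q = exc_set S q \<union> (if m < 0 then {m} else {})"
    using assms permutes_not_in[of q S m] by (auto simp: exc_set_def)
  moreover have "m \<notin> exc_set S q" "finite (exc_set S q)"
    using assms exc_set_subset by (auto intro: finite_subset)
  ultimately show ?thesis by (simp add: excB_eq_card)
qed

text \<open>The new letter is placed in the cycle between \<open>c\<close> and \<open>q c\<close>;
  no other value changes. If \<open>m\<close> is the largest letter, \<open>c\<close> is an
  excedance afterwards and \<open>m\<close> is not; if \<open>m\<close> is the smallest, it is the
  other way round. In both cases exactly one excedance replaces the former status of
  \<open>c\<close>.\<close>

lemma excB_insert_cycle:
  assumes S: "finite S" "m \<notin> S" and q: "q permutes S" and c: "c \<in> S"
    and m: "(m > 0 \<and> (\<forall>s\<in>S. s < m)) \<or> (m < 0 \<and> (\<forall>s\<in>S. m < s))"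
  shows "excB (insert m S) (transpose m (q c) \<circ> q) = (if c \<in> exc_set S q then excB S q else Suc (excB S q))"
proof -
  let ?w = "transpose m (q c) \<circ> q"
  have qm: "q m = m" using q S(2) by (rule permutes_not_in)
  have qS: "q a \<in> S" if "a \<in> S" for a using q that by (simp add: permutes_in_image)
  have wc: "?w c = m" by simp
  have wm: "?w m = q c" using qm by simp
  have wa: "?w a = q a" if "a \<in> S" "a \<noteq> c" for a
  proof -
    have "q a \<noteq> q c" using q that permutes_inj by (metis injD)
    moreover have "q a \<noteq> m" using qS that S(2) by blast
    ultimately show ?thesis by (simp add: transpose_apply_other)
  qed
  have qc: "q c \<in> S" using qS c by blast
  have "a \<in> exc_set (insert m S) ?w \<longleftrightarrow> a \<in> insert (if m > 0 then c else m) (exc_set S q - {c})" for a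
  proof -
    consider "a = m" | "a = c" | "a \<in> S" "a \<noteq> c" "a \<noteq> m" | "a \<notin> insert m S" by blast
    then show ?thesis
    proof cases
      case 1
      then show ?thesis using wm m c qc S(2) unfolding exc_set_def
        by (cases "m > 0") (auto simp del: o_apply)
    next
      case 2
      then show ?thesis using wc m c S(2) unfolding exc_set_def
        by (cases "m > 0") (auto simp del: o_apply)
    next
      case 3
      then show ?thesis using wa[OF 3(1,2)] by (auto simp: exc_set_def simp del: o_apply)
    next
      case 4
      then show ?thesis using c by (auto simp: exc_set_def simp del: o_apply)
    qed
  qed
  then have "exc_set (insert m S) ?w = insert (if m > 0 then c else m) (exc_set S q - {c})" by blast
  moreover have fin: "finite (exc_set S q)" using S exc_set_subset by (auto intro: finite_subset)
  moreover have "(if m > 0 then c else m) \<notin> exc_set S q - {c}" using S exc_set_subset by auto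
  ultimately have "excB (insert m S) ?w = Suc (card (exc_set S q - {c}))"
    unfolding excB_eq_card by simp
  then show ?thesis
    using card_Suc_Diff1[OF fin, of c] by (cases "c \<in> exc_set S q") (simp_all add: excB_eq_card)
qed

text \<open>Either \<open>m\<close> becomes a fixed point, which is an excedance precisely if
  \<open>m\<close> is negative, or it enters a cycle after some \<open>c\<close>. The latter keeps
  the number of excedances if \<open>c\<close> is one and raises it by one otherwise.\<close>

lemma sum_exc_insert:
  fixes x :: "'b::comm_ring_1"
  assumes S: "finite S" "m \<notin> S"
    and m: "(m > 0 \<and> (\<forall>s\<in>S. s < m)) \<or> (m < 0 \<and> (\<forall>s\<in>S. m < s))"
  shows "(\<Sum>w | w permutes insert m S. x ^ excB (insert m S) w) =
    (\<Sum>q | q permutes S. x ^ (excB S q + (if m < 0 then 1 else 0)) + of_nat (excB S q) * x ^ excB S q +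
       (of_nat (card S) - of_nat (excB S q)) * x ^ Suc (excB S q))"
proof -
  have "(\<Sum>w | w permutes insert m S. x ^ excB (insert m S) w) =
    (\<Sum>q | q permutes S. \<Sum>b\<in>insert m S. x ^ excB (insert m S) (transpose m b \<circ> q))"
    by (subst sum_over_permutations_insert[OF S]) (rule sum.swap)
  also have "\<dots> = (\<Sum>q | q permutes S. x ^ (excB S q + (if m < 0 then 1 else 0)) + of_nat (excB S q) * x ^ excB S q +
       (of_nat (card S) - of_nat (excB S q)) * x ^ Suc (excB S q))"
  proof (rule sum.cong[OF refl])
    fix q assume "q \<in> {q. q permutes S}"
    then have q: "q permutes S" by simp
    let ?E = "exc_set S q"
    \<comment> \<open>The value \<open>b\<close> taken by \<open>m\<close> is replaced by its
      preimage \<open>c\<close> under \<open>q\<close>, on which the change of the excedance number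
      depends.\<close>
    have "(\<Sum>b\<in>S. x ^ excB (insert m S) (transpose m b \<circ> q)) =
        (\<Sum>c\<in>S. x ^ excB (insert m S) (transpose m (q c) \<circ> q))"
      by (rule sum.reindex_bij_betw[OF permutes_imp_bij[OF q], symmetric])
    also have "\<dots> = (\<Sum>c\<in>S. x ^ (if c \<in> ?E then excB S q else Suc (excB S q)))"
      using excB_insert_cycle[OF S q _ m] by simp
    also have "\<dots> = (\<Sum>c\<in>?E. x ^ (if c \<in> ?E then excB S q else Suc (excB S q))) +
        (\<Sum>c\<in>S - ?E. x ^ (if c \<in> ?E then excB S q else Suc (excB S q)))"
      by (subst add.commute) (rule sum.subset_diff[OF exc_set_subset S(1)])
    also have "\<dots> = of_nat (excB S q) * x ^ excB S q + (of_nat (card S) - of_nat (excB S q)) * x ^ Suc (excB S q)"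
    proof -
      have "card ?E \<le> card S" "finite ?E" using S exc_set_subset by (auto intro: card_mono finite_subset)
      then show ?thesis
        using exc_set_subset by (simp add: card_Diff_subset of_nat_diff excB_eq_card)
    qed
    finally show "(\<Sum>b\<in>insert m S. x ^ excB (insert m S) (transpose m b \<circ> q)) =
       x ^ (excB S q + (if m < 0 then 1 else 0)) + of_nat (excB S q) * x ^ excB S q +
       (of_nat (card S) - of_nat (excB S q)) * x ^ Suc (excB S q)"
      using S excB_insert_fixed[OF S q] by (simp add: add.assoc)
  qed
  finally show ?thesis .
qed

text \<open>Both the block recursion and the insertion recursion of \<open>eB n\<close> are read off from
  \<open>eB n = (1 - x)\<^bsup>n + 1\<^esup> * (\<Sum>m. (2 * m + 1)\<^sup>n * x\<^sup>m)\<close>.\<close>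

definition odd_power_fps :: "nat \<Rightarrow> real fps" where
  "odd_power_fps n = Abs_fps (\<lambda>m. (2 * real m + 1) ^ n)"

text \<open>Expand \<open>2 * m + 1 = (2 * (m - 1) + 1) + 2\<close> by the binomial theorem.
  Multiplication by \<open>fps_X\<close> performs the shift of \<open>m\<close>, and the summand
  \<open>k = n\<close> moves to the left as the factor \<open>1 - fps_X\<close>.\<close>

lemma odd_power_fps_rec:
  "(1 - fps_X) * odd_power_fps n =
     1 + fps_X * (\<Sum>k<n. of_nat (n choose k) * 2 ^ (n - k) * odd_power_fps k)"
proof -
  have "odd_power_fps n = 1 + fps_X * (\<Sum>k\<le>n. fps_const (of_nat (n choose k) * 2 ^ (n - k)) * odd_power_fps k)"
  proof (rule fps_ext)
    fix m
    show "fps_nth (odd_power_fps n) m =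
      fps_nth (1 + fps_X * (\<Sum>k\<le>n. fps_const (of_nat (n choose k) * 2 ^ (n - k)) * odd_power_fps k)) m"
    proof (cases m)
      case (Suc m')
      have "(2 * real m + 1) ^ n = ((2 * real m' + 1) + 2) ^ n" by (simp add: Suc algebra_simps)
      also have "\<dots> = (\<Sum>k\<le>n. of_nat (n choose k) * (2 * real m' + 1) ^ k * 2 ^ (n - k))"
        by (rule binomial_ring)
      finally show ?thesis
        by (simp add: Suc odd_power_fps_def fps_sum_nth algebra_simps)
    qed (simp add: odd_power_fps_def)
  qed
  also have "(\<Sum>k\<le>n. fps_const (of_nat (n choose k) * 2 ^ (n - k)) * odd_power_fps k) =
     (\<Sum>k<n. of_nat (n choose k) * 2 ^ (n - k) * odd_power_fps k) + odd_power_fps n"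
    by (simp flip: lessThan_Suc_atMost fps_const_mult fps_of_nat fps_const_power numeral_fps_const)
  finally show ?thesis by (simp add: algebra_simps)
qed

lemma fps_of_poly_of_nat: "fps_of_poly (of_nat k :: 'a::comm_ring_1 poly) = of_nat k"
  by (simp add: of_nat_poly fps_of_poly_const fps_of_nat)

text \<open>Multiplied by \<open>(1 - fps_X) ^ n\<close>, the recursion of
  \<open>odd_power_fps\<close> becomes the block recursion of \<open>eB\<close>.\<close>

lemma fps_of_eB: "fps_of_poly (eB n) = (1 - fps_X) ^ Suc n * odd_power_fps n"
proof (induction n rule: less_induct)
  case (less n)
  have y: "fps_of_poly [:1, -1 :: real:] = 1 - fps_X"
    by (simp add: fps_of_poly_pCons)
  have "fps_of_poly (eB n) = (1 - fps_X) ^ n + (\<Sum>k<n. of_nat (n choose k) * 2 ^ (n - k) *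
     (fps_X * (1 - fps_X) ^ (n - k - 1) * fps_of_poly (eB k)))"
    by (subst eB.simps) (simp only: fps_of_poly_add fps_of_poly_sum fps_of_poly_mult fps_of_poly_power y
        fps_of_poly_fps_X fps_of_poly_of_nat fps_of_poly_numeral)
  also have "\<dots> = (1 - fps_X) ^ n + (\<Sum>k<n. (1 - fps_X) ^ n * fps_X * (of_nat (n choose k) * 2 ^ (n - k) * odd_power_fps k))"
  proof (intro arg_cong2[where f = "(+)"] refl sum.cong)
    fix k assume "k \<in> {..<n}"
    then have k: "k < n" by simp
    have "(1 - fps_X :: real fps) ^ n = (1 - fps_X) ^ (n - k - 1) * (1 - fps_X) ^ Suc k"
      using k by (subst power_add[symmetric]) simp
    then show "of_nat (n choose k) * 2 ^ (n - k) * (fps_X * (1 - fps_X) ^ (n - k - 1) * fps_of_poly (eB k)) =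
       (1 - fps_X) ^ n * fps_X * (of_nat (n choose k) * 2 ^ (n - k) * odd_power_fps k)"
      using less[OF k] by (simp only: mult_ac)
  qed
  also have "\<dots> = (1 - fps_X) ^ n * ((1 - fps_X) * odd_power_fps n)"
    unfolding odd_power_fps_rec by (simp only: sum_distrib_left[symmetric] ring_distribs mult_1_right mult.assoc)
  finally show ?case by (simp add: mult_ac)
qed

text \<open>Multiplying the \<open>m\<close>-th coefficient by \<open>2 * m + 1\<close> is the
  operator \<open>1 + 2 * X * d/dX\<close> on power series; the product rule transfers it through
  the factor \<open>(1 - X) ^ Suc n\<close>.\<close>

lemma eB_Suc: "eB (Suc n) = [:1, 2 * real n + 1:] * eB n + [:0, 2, -2:] * pderiv (eB n)"
proof -
  let ?X = "fps_X :: real fps" and ?F = "odd_power_fps n"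
  have F: "odd_power_fps (Suc n) = ?F + 2 * ?X * fps_deriv ?F"
  proof (rule fps_ext)
    fix m show "fps_nth (odd_power_fps (Suc n)) m = fps_nth (?F + 2 * ?X * fps_deriv ?F) m"
      by (cases m) (simp_all add: odd_power_fps_def algebra_simps numeral_fps_const)
  qed
  have a: "fps_of_poly [:1, 2 * real n + 1:] = 1 + (2 * of_nat n + 1) * ?X"
    by (simp add: fps_of_poly_pCons fps_of_nat numeral_fps_const flip: fps_const_add fps_const_mult)
  have b: "fps_of_poly [:0, 2, -2 :: real:] = 2 * ?X * (1 - ?X)"
    by (simp add: fps_of_poly_pCons numeral_fps_const algebra_simps flip: fps_const_neg)
  have "fps_deriv (fps_of_poly (eB n)) =
      (1 - ?X) ^ Suc n * fps_deriv ?F - of_nat (Suc n) * (1 - ?X) ^ n * ?F"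
    unfolding fps_of_eB by (simp add: fps_deriv_power fps_of_nat algebra_simps del: power_Suc of_nat_Suc)
  then have "fps_of_poly ([:1, 2 * real n + 1:] * eB n + [:0, 2, -2:] * pderiv (eB n)) =
     (1 + (2 * of_nat n + 1) * ?X) * ((1 - ?X) ^ Suc n * ?F) +
     2 * ?X * (1 - ?X) * ((1 - ?X) ^ Suc n * fps_deriv ?F - of_nat (Suc n) * (1 - ?X) ^ n * ?F)"
    unfolding fps_of_poly_add fps_of_poly_mult fps_of_poly_pderiv a b by (simp only: fps_of_eB)
  also have "\<dots> = (1 - ?X) ^ Suc (Suc n) * (?F + 2 * ?X * fps_deriv ?F)"
    by (simp add: algebra_simps)
  also have "\<dots> = fps_of_poly (eB (Suc n))" by (simp only: fps_of_eB F)
  finally show ?thesis by (simp only: fps_of_poly_eq_iff)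
qed

lemma pderiv_sum: "pderiv (\<Sum>i\<in>A. f i) = (\<Sum>i\<in>A. pderiv (f i))"
  by (induction A rule: infinite_finite_induct) (auto simp: pderiv_add)

text \<open>Induction on the largest absolute value \<open>m\<close>, inserted once as
  \<open>m\<close> and once as \<open>- m\<close>, which are the largest and the smallest letter.
  Together the two insertions act on each \<open>[:0, 1:] ^ excB S q\<close> as the operator in
  \<open>eB_Suc\<close>.\<close>

lemma sum_exc_eB:
  assumes "finite N" "\<And>i. i \<in> N \<Longrightarrow> i > 0"
  shows "(\<Sum>S\<in>signed_sets N. \<Sum>w | w permutes S. [:0, 1:] ^ excB S w) = eB (card N)"
  using assms
proof (induction N rule: finite_linorder_max_induct)
  case empty
  then show ?case by (simp add: signed_sets_empty eB.simps[of 0] excB_def)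
next
  case (insert m N)
  let ?X = "[:0, 1:] :: real poly" and ?n = "of_nat (card N) :: real poly"
  have m: "m > 0" "m \<notin> N" using insert by auto
  have "(\<Sum>S\<in>signed_sets (insert m N). \<Sum>w | w permutes S. ?X ^ excB S w) =
    (\<Sum>S\<in>signed_sets N. (\<Sum>w | w permutes insert m S. ?X ^ excB (insert m S) w) +
        (\<Sum>w | w permutes insert (- m) S. ?X ^ excB (insert (- m) S) w))"
    by (rule sum_signed_sets_insert[OF insert.hyps(1) m])
  also have "\<dots> = (\<Sum>S\<in>signed_sets N. \<Sum>q | q permutes S.
      [:1, 2 * real (card N) + 1:] * ?X ^ excB S q + [:0, 2, -2:] * pderiv (?X ^ excB S q))"
  proof (rule sum.cong[OF refl])
    fix S assume S: "S \<in> signed_sets N"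
    have fS: "finite S" using insert.hyps(1) S by (rule signed_sets_finite)
    have ab: "\<bar>s\<bar> < m" if "s \<in> S" for s
    proof -
      have "\<bar>s\<bar> \<in> N" using S that by (auto simp: signed_sets_def)
      then show ?thesis using insert.hyps(2) by blast
    qed
    have 1: "m \<notin> S" "- m \<notin> S" using signed_sets_insert_notin[OF m S] .
    have 2: "(m > 0 \<and> (\<forall>s\<in>S. s < m)) \<or> (m < 0 \<and> (\<forall>s\<in>S. m < s))" using m ab by force
    have 3: "(- m > 0 \<and> (\<forall>s\<in>S. s < - m)) \<or> (- m < 0 \<and> (\<forall>s\<in>S. - m < s))" using m ab by force
    have pd: "(?X ^ e + of_nat e * ?X ^ e + (?n - of_nat e) * ?X ^ Suc e) +
         (?X ^ (e + 1) + of_nat e * ?X ^ e + (?n - of_nat e) * ?X ^ Suc e) =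
       [:1, 2 * real (card N) + 1:] * ?X ^ e + [:0, 2, -2:] * pderiv (?X ^ e)" for e
    proof (rule poly_ext)
      fix x
      have pdX: "pderiv (?X ^ e) = smult (of_nat e) (?X ^ (e - 1))"
        by (simp add: pderiv_power pderiv_pCons)
      show "poly ((?X ^ e + of_nat e * ?X ^ e + (?n - of_nat e) * ?X ^ Suc e) +
         (?X ^ (e + 1) + of_nat e * ?X ^ e + (?n - of_nat e) * ?X ^ Suc e)) x =
         poly ([:1, 2 * real (card N) + 1:] * ?X ^ e + [:0, 2, -2:] * pderiv (?X ^ e)) x"
        unfolding pdX by (cases e) (simp_all add: algebra_simps)
    qed
    show "(\<Sum>w | w permutes insert m S. ?X ^ excB (insert m S) w) +
        (\<Sum>w | w permutes insert (- m) S. ?X ^ excB (insert (- m) S) w) =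
        (\<Sum>q | q permutes S.
      [:1, 2 * real (card N) + 1:] * ?X ^ excB S q + [:0, 2, -2:] * pderiv (?X ^ excB S q))"
      unfolding sum_exc_insert[OF fS 1(1) 2] sum_exc_insert[OF fS 1(2) 3] sum.distrib[symmetric]
        signed_sets_card[OF S] pd[symmetric]
      using m by simp
  qed
  also have "\<dots> = [:1, 2 * real (card N) + 1:] * (\<Sum>S\<in>signed_sets N. \<Sum>w | w permutes S. ?X ^ excB S w) +
      [:0, 2, -2:] * pderiv (\<Sum>S\<in>signed_sets N. \<Sum>w | w permutes S. ?X ^ excB S w)"
    by (simp only: sum.distrib sum_distrib_left pderiv_sum)
  also have "\<dots> = eB (Suc (card N))" 
    using insert.IH insert.prems by (simp only: eB_Suc insertI2)
  finally show ?case using insert.hyps m by simp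
qed

section \<open>Inclusion-exclusion over positive fixed points\<close>

lemma sum_Pow_alternating:
  assumes "finite A"
  shows "(\<Sum>T\<in>Pow A. (-1) ^ card T) = (if A = {} then 1 else 0 :: 'b::comm_ring_1)"
  using sum_Pow_by_card[OF assms, of "\<lambda>k. (-1) ^ k :: 'b"] choose_alternating_sum[of "card A", where ?'a = 'b] assms
  by (auto simp: card_gt_0_iff mult.commute)

text \<open>A positive fixed point is not an excedance. Deleting the fixed points in
  \<open>T\<close> therefore preserves \<open>excB\<close> and leaves an arbitrary signed
  permutation on \<open>N - T\<close>.\<close>

lemma sum_exc_fixing:
  assumes N: "finite N" "\<And>i. i \<in> N \<Longrightarrow> i > 0" and T: "T \<subseteq> N"
  shows "(\<Sum>p\<in>{p \<in> (SIGMA S:signed_sets N. {w. w permutes S}). T \<subseteq> {a \<in> fst p. a > 0 \<and> snd p a = a}}.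
     [:0, 1:] ^ excB (fst p) (snd p)) = eB (card N - card T)"
proof -
  have fT: "finite T" using T N finite_subset by blast
  have absT: "abs ` T = T"
  proof -
    have "abs ` T = (\<lambda>t. t) ` T" using N(2) T by (intro image_cong) (auto simp: abs_of_pos)
    then show ?thesis by simp
  qed
  have "(\<Sum>p\<in>{p \<in> (SIGMA S:signed_sets N. {w. w permutes S}). T \<subseteq> {a \<in> fst p. a > 0 \<and> snd p a = a}}.
     [:0, 1:] ^ excB (fst p) (snd p)) =
     (\<Sum>p\<in>(SIGMA S:signed_sets (N - T). {w. w permutes S}). [:0, 1:] ^ excB (fst p) (snd p) :: real poly)"
  proof (rule sum.reindex_bij_witness[where i = "\<lambda>(S, w). (S \<union> T, w)" and j = "\<lambda>(S, w). (S - T, w)"], goal_cases)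
    case (1 a)
    then show ?case by auto
  next
    case (2 a)
    then obtain S w where a: "a = (S, w)" "S \<in> signed_sets N" "w permutes S" "T \<subseteq> S" "\<forall>t\<in>T. w t = t"
      by (cases a) auto
    have "S - T \<in> signed_sets (N - T)"
      using a(2,4) absT inj_on_image_set_diff[of abs S S T] by (auto simp: signed_sets_def inj_on_diff)
    moreover have "w permutes (S - T)"
      by (rule permutes_superset[OF a(3)]) (use a(5) in auto)
    ultimately show ?case using a by simp
  next
    case (3 b)
    then show ?case using absT by (fastforce simp: signed_sets_def)
  next
    case (4 b)
    then obtain S w where b: "b = (S, w)" "S \<in> signed_sets (N - T)" "w permutes S" by auto
    have disj: "abs ` S \<inter> abs ` T = {}" using b(2) absT by (auto simp: signed_sets_def)
    have injT: "inj_on abs T"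
      using T N(2) by (intro inj_onI) (metis abs_of_pos subsetD)
    have "inj_on abs (S \<union> T)"
      using b(2) injT disj unfolding inj_on_Un signed_sets_def by blast
    moreover have "abs ` (S \<union> T) = N"
      using b(2) absT T by (auto simp: signed_sets_def image_Un)
    ultimately have "S \<union> T \<in> signed_sets N" by (simp add: signed_sets_def)
    moreover have "w permutes (S \<union> T)" using b(3) by (rule permutes_subset) auto
    moreover have "w t = t" if "t \<in> T" for t
      using b(3) that disj by (intro permutes_not_in) auto
    ultimately show ?case using b T N(2) by auto
  next
    case (5 a)
    then obtain S w where a: "a = (S, w)" "T \<subseteq> S" "\<forall>t\<in>T. t > 0 \<and> w t = t"
      by (cases a) auto
    then have "exc_set (S - T) w = exc_set S w" by (force simp: exc_set_def)
    then show ?case using a by (simp add: excB_eq_card)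
  qed
  also have "\<dots> = (\<Sum>S\<in>signed_sets (N - T). \<Sum>w | w permutes S. [:0, 1:] ^ excB S w)"
  proof -
    have "finite {w. w permutes S}" if "S \<in> signed_sets (N - T)" for S
      using N(1) signed_sets_finite[OF _ that] by (simp add: finite_permutations)
    then show ?thesis
      using N(1) by (subst sum.Sigma) (auto simp: finite_signed_sets case_prod_beta)
  qed
  also have "\<dots> = eB (card N - card T)"
    using N T fT by (subst sum_exc_eB) (auto simp: card_Diff_subset)
  finally show ?thesis .
qed

lemma dB_eq_alternating_sum:
  "dB n = (\<Sum>k\<le>n. smult ((-1) ^ (n - k) * real (n choose k)) (eB k))"
proof -
  define SP where "SP = (SIGMA S:signed_sets {1..int n}. {w. w permutes S})"
  define fix_pos where "fix_pos p = {a \<in> fst p. a > 0 \<and> snd p a = a}" for p :: "int set \<times> (int \<Rightarrow> int)"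
  let ?N = "{1..int n}"
  have fSP: "finite SP" using finite_signed_perms[of n] by (simp add: SP_def signed_perms_eq)
  have fpN: "fix_pos p \<subseteq> ?N" if "p \<in> SP" for p
  proof
    fix a assume "a \<in> fix_pos p"
    then have "a \<in> fst p" "a > 0" by (auto simp: fix_pos_def)
    moreover have "abs ` fst p = ?N" using that by (auto simp: SP_def signed_sets_def simp del: atLeastAtMost_iff)
    ultimately have "\<bar>a\<bar> \<in> ?N" "a > 0" by blast+
    then show "a \<in> ?N" by simp
  qed
  have "dB n = (\<Sum>p\<in>{p \<in> SP. fix_pos p = {}}. [:0, 1:] ^ excB (fst p) (snd p))"
  proof (cases "n = 0")
    case True
    have "SP = {({}, id)}" using True by (auto simp: SP_def signed_sets_empty)
    then have "{p \<in> SP. fix_pos p = {}} = {({}, id)}" by (auto simp: fix_pos_def)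
    then show ?thesis using True by (simp add: dB_def excB_def)
  next
    case False
    have "{p \<in> signed_perms n. is_derangement (fst p) (snd p)} = {p \<in> SP. fix_pos p = {}}"
      by (auto simp: SP_def signed_perms_eq is_derangement_def fix_pos_def)
    then show ?thesis using False by (simp add: dB_def monom_altdef)
  qed
  \<comment> \<open>The alternating sum over \<open>Pow (fix_pos p)\<close> is the indicator of the
    derangements; exchanging the two sums then reduces to \<open>sum_exc_fixing\<close>.\<close>
  also have "\<dots> = (\<Sum>p\<in>SP. (\<Sum>T\<in>Pow (fix_pos p). (-1) ^ card T) * [:0, 1:] ^ excB (fst p) (snd p))"
  proof -
    have "(\<Sum>T\<in>Pow (fix_pos p). (-1) ^ card T) * [:0, 1:] ^ excB (fst p) (snd p) =
        (if fix_pos p = {} then [:0, 1:] ^ excB (fst p) (snd p) else 0 :: real poly)" if "p \<in> SP" for p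
      using sum_Pow_alternating[of "fix_pos p", where ?'b = "real poly"] fpN[OF that] finite_subset by fastforce
    then show ?thesis using fSP by (simp add: sum.inter_filter cong: sum.cong)
  qed
  also have "\<dots> = (\<Sum>p\<in>SP. \<Sum>T | T \<in> Pow ?N \<and> T \<subseteq> fix_pos p. (-1) ^ card T * [:0, 1:] ^ excB (fst p) (snd p))"
    using fpN by (auto simp: sum_distrib_right intro!: sum.cong)
  also have "\<dots> = (\<Sum>T\<in>Pow ?N. \<Sum>p | p \<in> SP \<and> T \<subseteq> fix_pos p. (-1) ^ card T * [:0, 1:] ^ excB (fst p) (snd p))"
    using fSP by (intro sum.swap_restrict) auto
  also have "\<dots> = (\<Sum>T\<in>Pow ?N. (-1) ^ card T * eB (n - card T))"
    using sum_exc_fixing[of ?N] unfolding SP_def fix_pos_def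
    by (intro sum.cong refl) (simp flip: sum_distrib_left)
  also have "\<dots> = (\<Sum>k\<le>n. of_nat (n choose k) * ((-1) ^ k * eB (n - k)))"
    by (subst sum_Pow_by_card) auto
  also have "\<dots> = (\<Sum>k\<le>n. of_nat (n choose k) * ((-1) ^ (n - k) * eB k))"
    by (rule sum.reindex_bij_witness[of _ "\<lambda>k. n - k" "\<lambda>k. n - k"]) (auto simp: binomial_symmetric[symmetric])
  also have "\<dots> = (\<Sum>k\<le>n. smult ((-1) ^ (n - k) * real (n choose k)) (eB k))"
  proof (intro sum.cong refl)
    fix k
    have "of_nat (n choose k) * (-1) ^ (n - k) = [:(-1) ^ (n - k) * real (n choose k):]"
      by (cases "even (n - k)") (simp_all add: of_nat_poly)
    then show "of_nat (n choose k) * ((-1) ^ (n - k) * eB k) = smult ((-1) ^ (n - k) * real (n choose k)) (eB k)"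
      by (simp flip: mult.assoc)
  qed
  finally show ?thesis .
qed

section \<open>Chains of intervals\<close>

definition chains_of :: "('a \<Rightarrow> 'a \<Rightarrow> bool) \<Rightarrow> 'a set \<Rightarrow> 'a set set" where
  "chains_of le X = {c. c \<subseteq> X \<and> (\<forall>p\<in>c. \<forall>q\<in>c. le p q \<or> le q p)}"

lemma chain_has_top:
  assumes "finite c" "c \<noteq> {}" "\<forall>p\<in>c. \<forall>q\<in>c. le p q \<or> le q p" "transp le"
  shows "\<exists>m\<in>c. \<forall>p\<in>c. le p m"
  using assms(1-3)
proof (induction c rule: finite_ne_induct)
  case (insert a c)
  then obtain m where m: "m \<in> c" "\<forall>p\<in>c. le p m" by auto
  then have "le a m \<or> le m a" "le a a" using insert.prems by auto
  then show ?case using m assms(4) by (metis insert_iff transpD)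
qed auto

lemma chain_top_eq:
  assumes "antisymp le" "m \<in> c" "\<forall>p\<in>c. le p m"
  shows "(THE m. m \<in> c \<and> (\<forall>p\<in>c. le p m)) = m"
  using assms by (intro the_equality) (auto dest: antisympD)

text \<open>The empty chain gives 1; any other chain consists of its top element \<open>t\<close>
  and a chain strictly below \<open>t\<close>.\<close>

lemma sum_chains_by_top:
  fixes y :: "'b::comm_ring_1"
  assumes X: "finite X" and le: "reflp le" "transp le" "antisymp le"
  shows "(\<Sum>c\<in>chains_of le X. y ^ card c) =
    1 + y * (\<Sum>t\<in>X. \<Sum>c\<in>chains_of le {p \<in> X. le p t \<and> p \<noteq> t}. y ^ card c)"
proof -
  define top where "top c = (THE m. m \<in> c \<and> (\<forall>p\<in>c. le p m))" for c
  have fin: "finite (chains_of le Y)" if "Y \<subseteq> X" for Y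
    by (rule finite_subset[of _ "Pow X"]) (use X that in \<open>auto simp: chains_of_def\<close>)
  have top: "top c \<in> c \<and> (\<forall>p\<in>c. le p (top c))" if c: "c \<in> chains_of le X" "c \<noteq> {}" for c
  proof -
    have "finite c" using c X by (auto simp: chains_of_def intro: finite_subset)
    then obtain m where "m \<in> c" "\<forall>p\<in>c. le p m"
      using chain_has_top[OF _ c(2) _ le(2)] c(1) unfolding chains_of_def by blast
    then show ?thesis using chain_top_eq[OF le(3), of m c] unfolding top_def by simp
  qed
  have top_ins: "top (insert t c) = t" if "c \<in> chains_of le {p \<in> X. le p t \<and> p \<noteq> t}" for t c
    unfolding top_def using that le(1) by (intro chain_top_eq[OF le(3)]) (auto simp: chains_of_def reflpD)
  have "(\<Sum>c\<in>chains_of le X - {{}}. y ^ card c) =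
    (\<Sum>(t, c)\<in>(SIGMA t:X. chains_of le {p \<in> X. le p t \<and> p \<noteq> t}). y * y ^ card c)"
  proof (rule sum.reindex_bij_witness[where i = "\<lambda>(t, c). insert t c" and j = "\<lambda>c. (top c, c - {top c})"], goal_cases)
    case (1 c)
    then show ?case using top[of c] by auto
  next
    case (2 c)
    then show ?case using top[of c] by (auto simp: chains_of_def)
  next
    case (3 b)
    then show ?case using top_ins by (auto simp: chains_of_def)
  next
    case (4 b)
    then show ?case using le(1) by (auto simp: chains_of_def reflpD)
  next
    case (5 c)
    then have "finite c" using X by (auto simp: chains_of_def intro: finite_subset)
    then show ?case using 5 top[of c] card_Suc_Diff1[of c "top c"] by (simp flip: power_Suc)
  qed
  also have "\<dots> = y * (\<Sum>t\<in>X. \<Sum>c\<in>chains_of le {p \<in> X. le p t \<and> p \<noteq> t}. y ^ card c)"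
    using X fin by (subst sum.Sigma[symmetric]) (auto simp: sum_distrib_left)
  finally show ?thesis
    using sum.remove[of "chains_of le X" "{}" "\<lambda>c. y ^ card c"] fin[of X] by (simp add: chains_of_def)
qed

section \<open>Intervals of the Boolean lattice\<close>

lemma int_le_order: "reflp int_le" "transp int_le" "antisymp int_le"
proof -
  show "transp int_le" unfolding transp_def int_le_def by (meson subset_trans)
qed (auto simp: int_le_def intro!: reflpI antisympI)

definition intervals_in :: "nat set \<Rightarrow> (nat set \<times> nat set) set" where
  "intervals_in F = {(A, B). A \<noteq> {} \<and> A \<subseteq> B \<and> B \<subseteq> F}"

definition proper_subintervals :: "nat set \<times> nat set \<Rightarrow> (nat set \<times> nat set) set" where
  "proper_subintervals t = {(A, B). fst t \<subseteq> A \<and> A \<subseteq> B \<and> B \<subseteq> snd t \<and> (A, B) \<noteq> t}"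

lemma below_interval:
  "t \<in> intervals_in F \<Longrightarrow> {p \<in> intervals_in F. int_le p t \<and> p \<noteq> t} = proper_subintervals t"
proof -
  assume "t \<in> intervals_in F"
  then have t: "fst t \<noteq> {}" "snd t \<subseteq> F" by (auto simp: intervals_in_def)
  show ?thesis
  proof (intro equalityI subsetI)
    fix q assume "q \<in> {p \<in> intervals_in F. int_le p t \<and> p \<noteq> t}"
    then show "q \<in> proper_subintervals t"
      by (auto simp: proper_subintervals_def intervals_in_def int_le_def)
  next
    fix q assume q: "q \<in> proper_subintervals t"
    then have q': "fst t \<subseteq> fst q" "fst q \<subseteq> snd q" "snd q \<subseteq> snd t" "q \<noteq> t"
      by (auto simp: proper_subintervals_def)
    then have "fst q \<noteq> {}" "snd q \<subseteq> F" using t by auto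
    then show "q \<in> {p \<in> intervals_in F. int_le p t \<and> p \<noteq> t}"
      using q' by (simp add: intervals_in_def int_le_def split_beta)
  qed
qed

text \<open>What lies strictly below an interval does not depend on the surrounding interval, so the
  recursion over top elements stays within the family \<open>proper_subintervals\<close>.\<close>

lemma below_subinterval:
  "p \<in> proper_subintervals t \<Longrightarrow>
     {q \<in> proper_subintervals t. int_le q p \<and> q \<noteq> p} = proper_subintervals p"
proof -
  assume p: "p \<in> proper_subintervals t"
  show ?thesis
  proof (intro equalityI subsetI)
    fix q assume "q \<in> {q \<in> proper_subintervals t. int_le q p \<and> q \<noteq> p}"
    then show "q \<in> proper_subintervals p" by (auto simp: proper_subintervals_def int_le_def)
  next
    fix q assume q: "q \<in> proper_subintervals p"
    have p': "fst t \<subseteq> fst p" "snd p \<subseteq> snd t" "p \<noteq> t" using p by (auto simp: proper_subintervals_def)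
    have q': "fst p \<subseteq> fst q" "fst q \<subseteq> snd q" "snd q \<subseteq> snd p" "q \<noteq> p"
      using q by (auto simp: proper_subintervals_def)
    have "q \<noteq> t"
    proof
      assume "q = t"
      then have "fst p = fst t" "snd p = snd t" using p' q' by auto
      then show False using p'(3) by (simp add: prod_eq_iff)
    qed
    moreover have "fst t \<subseteq> fst q" "snd q \<subseteq> snd t"
      using p' q' by (meson subset_trans)+
    ultimately show "q \<in> {q \<in> proper_subintervals t. int_le q p \<and> q \<noteq> p}"
      using q' by (simp add: proper_subintervals_def int_le_def split_beta)
  qed
qed

lemma finite_intervals_in: "finite F \<Longrightarrow> finite (intervals_in F)"
  by (rule finite_subset[of _ "Pow F \<times> Pow F"]) (auto simp: intervals_in_def)

lemma finite_proper_subintervals: "finite (snd t) \<Longrightarrow> finite (proper_subintervals t)"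
  by (rule finite_subset[of _ "Pow (snd t) \<times> Pow (snd t)"]) (auto simp: proper_subintervals_def)

text \<open>In a subinterval each element of \<open>B - A\<close> belongs to the lower end, or is
  missing from the upper end, or is free. Let \<open>U\<close> be the set of free elements, which is
  not all of \<open>B - A\<close> for a proper subinterval, and \<open>V\<close> the set added to
  the lower end; \<open>V\<close> is any subset of the rest.\<close>

lemma sum_proper_subintervals:
  fixes g :: "nat \<Rightarrow> real"
  assumes "finite B" "A \<subseteq> B"
  shows "(\<Sum>p\<in>proper_subintervals (A, B). g (card (snd p - fst p))) =
    (\<Sum>k<card (B - A). of_nat (card (B - A) choose k) * (2 ^ (card (B - A) - k) * g k))"
proof -
  let ?D = "B - A"
  have fin: "finite ?D" using assms by simp
  have "(\<Sum>p\<in>proper_subintervals (A, B). g (card (snd p - fst p))) =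
     (\<Sum>(U, V)\<in>(SIGMA U:Pow ?D - {?D}. Pow (?D - U)). g (card U))"
  proof (rule sum.reindex_bij_witness[where i = "\<lambda>(U, V). (A \<union> V, A \<union> V \<union> U)" and
        j = "\<lambda>p. (snd p - fst p, fst p - A)"], goal_cases)
    case (2 p)
    then obtain A' B' where p: "p = (A', B')" "A \<subseteq> A'" "A' \<subseteq> B'" "B' \<subseteq> B" "(A', B') \<noteq> (A, B)"
      by (auto simp: proper_subintervals_def)
    have "B' - A' \<noteq> B - A"
    proof
      assume "B' - A' = B - A"
      then have "A' = A" "B' = B" using p by blast+
      then show False using p by simp
    qed
    then show ?case using p by auto
  next
    case (4 b)
    then show ?case using assms by (auto simp: proper_subintervals_def)
  qed (auto simp: proper_subintervals_def)
  also have "\<dots> = (\<Sum>U\<in>Pow ?D - {?D}. 2 ^ (card ?D - card U) * g (card U))"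
    using fin
    by (subst sum.Sigma[symmetric]) (auto simp: card_Pow card_Diff_subset finite_subset intro!: sum.cong)
  also have "\<dots> = (\<Sum>k<card ?D. of_nat (card ?D choose k) * (2 ^ (card ?D - k) * g k))"
    by (rule sum_proper_subsets_by_card[OF fin])
  finally show ?thesis .
qed

text \<open>An interval is given by its free elements \<open>U\<close> and its lower end
  \<open>V\<close>, which is disjoint from \<open>U\<close> and nonempty; the latter explains the
  \<open>- 1\<close>. The summand \<open>k = card F\<close> vanishes since
  \<open>2 ^ 0 - 1 = 0\<close>.\<close>

lemma sum_intervals_in:
  fixes g :: "nat \<Rightarrow> real"
  assumes "finite F"
  shows "(\<Sum>p\<in>intervals_in F. g (card (snd p - fst p))) =
    (\<Sum>k<card F. of_nat (card F choose k) * ((2 ^ (card F - k) - 1) * g k))"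
proof -
  have "(\<Sum>p\<in>intervals_in F. g (card (snd p - fst p))) =
     (\<Sum>(U, V)\<in>(SIGMA U:Pow F. Pow (F - U) - {{}}). g (card U))"
    by (rule sum.reindex_bij_witness[where i = "\<lambda>(U, V). (V, V \<union> U)" and
        j = "\<lambda>p. (snd p - fst p, fst p)"]) (auto simp: intervals_in_def)
  also have "\<dots> = (\<Sum>U\<in>Pow F. (2 ^ (card F - card U) - 1) * g (card U))"
    using assms
    by (subst sum.Sigma[symmetric])
       (auto simp: card_Pow card_Diff_subset finite_subset of_nat_diff intro!: sum.cong)
  also have "\<dots> = (\<Sum>k\<le>card F. of_nat (card F choose k) * ((2 ^ (card F - k) - 1) * g k))"
    by (rule sum_Pow_by_card[OF assms])
  also have "\<dots> = (\<Sum>k<card F. of_nat (card F choose k) * ((2 ^ (card F - k) - 1) * g k))"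
    by (simp flip: lessThan_Suc_atMost)
  finally show ?thesis .
qed

lemma poly_eB_rec:
  "poly (eB n) x = (1 - x) ^ n + (\<Sum>k<n. of_nat (n choose k) * (2 ^ (n - k) *
     (x * (1 - x) ^ (n - k - 1) * poly (eB k) x)))"
  by (subst eB.simps) (simp add: poly_sum mult_ac)

lemma poly_Bplus_rec:
  "poly (Bplus n) x = (1 - x) ^ n + (\<Sum>k<n. of_nat (n choose k) * ((2 ^ (n - k) - 1) *
     (x * (1 - x) ^ (n - k - 1) * poly (eB k) x)))"
  by (subst Bplus_rec) (simp add: poly_sum mult_ac)

text \<open>Brings a summand of the chain recursion, normalised by \<open>(1 - x) ^ k\<close>, to
  the common denominator \<open>(1 - x) ^ n\<close>, where it becomes a summand of the block
  recursions.\<close>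

lemma power_diff_shift:
  fixes x :: real
  assumes "x \<noteq> 1" "k < n"
  shows "x / (1 - x) * (b / (1 - x) ^ k) = x * (1 - x) ^ (n - k - 1) * b / (1 - x) ^ n"
proof -
  have "(1 - x) ^ n = (1 - x) ^ (n - k - 1) * ((1 - x) * (1 - x) ^ k)"
    using assms(2) by (simp flip: power_add power_Suc)
  then show ?thesis using assms(1) by simp
qed

text \<open>A proper subinterval of \<open>[A, B]\<close> is a proper face of a cube of dimension \<open>card (B - A)\<close>, so
  only this dimension matters, and the recursion by the top element of a chain is the block recursion
  of \<open>eB\<close>.\<close>

lemma sum_chains_proper_subintervals:
  fixes x :: real
  assumes x: "x \<noteq> 1" and "finite B" "A \<subseteq> B"
  shows "(\<Sum>c\<in>chains_of int_le (proper_subintervals (A, B)). (x / (1 - x)) ^ card c) =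
    poly (eB (card (B - A))) x / (1 - x) ^ card (B - A)"
  using assms(2,3)
proof (induction "card (B - A)" arbitrary: A B rule: less_induct)
  case less
  let ?y = "x / (1 - x)" and ?m = "card (B - A)"
  define g where "g k = poly (eB k) x / (1 - x) ^ k" for k
  have "(\<Sum>c\<in>chains_of int_le (proper_subintervals (A, B)). ?y ^ card c) =
    1 + ?y * (\<Sum>t\<in>proper_subintervals (A, B). \<Sum>c\<in>chains_of int_le
       {p \<in> proper_subintervals (A, B). int_le p t \<and> p \<noteq> t}. ?y ^ card c)"
    using less.prems by (intro sum_chains_by_top finite_proper_subintervals int_le_order) simp
  also have "(\<Sum>t\<in>proper_subintervals (A, B). \<Sum>c\<in>chains_of int_le
       {p \<in> proper_subintervals (A, B). int_le p t \<and> p \<noteq> t}. ?y ^ card c) =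
    (\<Sum>t\<in>proper_subintervals (A, B). g (card (snd t - fst t)))"
  proof (rule sum.cong[OF refl])
    fix t assume t: "t \<in> proper_subintervals (A, B)"
    obtain A' B' where t': "t = (A', B')" by fastforce
    have "B' - A' \<subset> B - A" using t t' less.prems by (auto simp: proper_subintervals_def)
    then have "card (B' - A') < card (B - A)" using less.prems by (intro psubset_card_mono) auto
    moreover have "finite B'" "A' \<subseteq> B'"
      using t t' less.prems by (auto simp: proper_subintervals_def intro: finite_subset)
    ultimately show "(\<Sum>c\<in>chains_of int_le {p \<in> proper_subintervals (A, B). int_le p t \<and> p \<noteq> t}. ?y ^ card c) =
        g (card (snd t - fst t))"
      unfolding below_subinterval[OF t] using less.hyps[of B' A'] by (simp add: t' g_def)
  qed
  also have "\<dots> = (\<Sum>k<?m. of_nat (?m choose k) * (2 ^ (?m - k) * g k))"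
    by (rule sum_proper_subintervals[OF less.prems])
  also have "1 + ?y * \<dots> = 1 + (\<Sum>k<?m. of_nat (?m choose k) * (2 ^ (?m - k) *
      (x * (1 - x) ^ (?m - k - 1) * poly (eB k) x))) / (1 - x) ^ ?m"
    unfolding sum_distrib_left sum_divide_distrib
  proof (intro arg_cong2[where f = "(+)"] refl sum.cong)
    fix k assume "k \<in> {..<?m}"
    then have *: "?y * g k = x * (1 - x) ^ (?m - k - 1) * poly (eB k) x / (1 - x) ^ ?m"
      unfolding g_def by (intro power_diff_shift[OF x]) simp
    have "?y * (of_nat (?m choose k) * (2 ^ (?m - k) * g k)) = of_nat (?m choose k) * (2 ^ (?m - k) * (?y * g k))"
      by (simp only: mult_ac)
    then show "?y * (of_nat (?m choose k) * (2 ^ (?m - k) * g k)) = of_nat (?m choose k) * (2 ^ (?m - k) *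
      (x * (1 - x) ^ (?m - k - 1) * poly (eB k) x)) / (1 - x) ^ ?m"
      by (simp only: * times_divide_eq_right)
  qed
  also have "\<dots> = poly (eB ?m) x / (1 - x) ^ ?m"
    using x by (subst poly_eB_rec[of ?m]) (simp add: add_divide_distrib)
  finally show ?case .
qed

text \<open>The left side is the h-polynomial divided by \<open>(1 - x) ^ card F\<close>. Below its
  top element a chain contributes \<open>eB\<close> of the number of free elements, and counting the
  top elements gives the factors \<open>2 ^ (card F - k) - 1\<close> in the recursion of
  \<open>Bplus\<close>.\<close>

lemma sum_chains_intervals_in:
  fixes x :: real
  assumes x: "x \<noteq> 1" and F: "finite F"
  shows "(\<Sum>c\<in>chains_of int_le (intervals_in F). (x / (1 - x)) ^ card c) =
    poly (Bplus (card F)) x / (1 - x) ^ card F"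
proof -
  let ?y = "x / (1 - x)" and ?m = "card F"
  define g where "g k = poly (eB k) x / (1 - x) ^ k" for k
  have "(\<Sum>c\<in>chains_of int_le (intervals_in F). ?y ^ card c) =
    1 + ?y * (\<Sum>t\<in>intervals_in F. \<Sum>c\<in>chains_of int_le {p \<in> intervals_in F. int_le p t \<and> p \<noteq> t}. ?y ^ card c)"
    using F by (intro sum_chains_by_top finite_intervals_in int_le_order)
  also have "(\<Sum>t\<in>intervals_in F. \<Sum>c\<in>chains_of int_le {p \<in> intervals_in F. int_le p t \<and> p \<noteq> t}. ?y ^ card c) =
    (\<Sum>t\<in>intervals_in F. g (card (snd t - fst t)))"
  proof (rule sum.cong[OF refl])
    fix t assume t: "t \<in> intervals_in F"
    obtain A' B' where t': "t = (A', B')" by fastforce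
    have "finite B'" "A' \<subseteq> B'"
      using t t' F by (auto simp: intervals_in_def intro: finite_subset)
    then show "(\<Sum>c\<in>chains_of int_le {p \<in> intervals_in F. int_le p t \<and> p \<noteq> t}. ?y ^ card c) =
        g (card (snd t - fst t))"
      unfolding below_interval[OF t] using sum_chains_proper_subintervals[OF x] by (simp add: t' g_def)
  qed
  also have "\<dots> = (\<Sum>k<?m. of_nat (?m choose k) * ((2 ^ (?m - k) - 1) * g k))"
    by (rule sum_intervals_in[OF F])
  also have "1 + ?y * \<dots> = 1 + (\<Sum>k<?m. of_nat (?m choose k) * ((2 ^ (?m - k) - 1) *
      (x * (1 - x) ^ (?m - k - 1) * poly (eB k) x))) / (1 - x) ^ ?m"
    unfolding sum_distrib_left sum_divide_distrib
  proof (intro arg_cong2[where f = "(+)"] refl sum.cong)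
    fix k assume "k \<in> {..<?m}"
    then have *: "?y * g k = x * (1 - x) ^ (?m - k - 1) * poly (eB k) x / (1 - x) ^ ?m"
      unfolding g_def by (intro power_diff_shift[OF x]) simp
    have "?y * (of_nat (?m choose k) * ((2 ^ (?m - k) - 1) * g k)) = of_nat (?m choose k) * ((2 ^ (?m - k) - 1) * (?y * g k))"
      by (simp only: mult_ac)
    then show "?y * (of_nat (?m choose k) * ((2 ^ (?m - k) - 1) * g k)) = of_nat (?m choose k) * ((2 ^ (?m - k) - 1) *
      (x * (1 - x) ^ (?m - k - 1) * poly (eB k) x)) / (1 - x) ^ ?m"
      by (simp only: * times_divide_eq_right)
  qed
  also have "\<dots> = poly (Bplus ?m) x / (1 - x) ^ ?m"
    using x by (subst poly_Bplus_rec[of ?m]) (simp add: add_divide_distrib)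
  finally show ?thesis .
qed

text \<open>The number of free elements separates the members of a chain, and it is smaller than
  \<open>card F\<close> because lower ends are nonempty.\<close>

lemma interval_chain_card_le:
  assumes "finite F" "c \<in> chains_of int_le (intervals_in F)"
  shows "card c \<le> card F"
proof -
  have c: "c \<subseteq> intervals_in F" "\<forall>p\<in>c. \<forall>q\<in>c. int_le p q \<or> int_le q p"
    using assms(2) by (auto simp: chains_of_def)
  have fin: "finite (snd p)" "fst p \<subseteq> snd p" "fst p \<noteq> {}" "snd p \<subseteq> F" if "p \<in> c" for p
  proof -
    have "p \<in> intervals_in F" using that c(1) by blast
    then show "fst p \<subseteq> snd p" "fst p \<noteq> {}" "snd p \<subseteq> F" by (auto simp: intervals_in_def)
    then show "finite (snd p)" using assms(1) finite_subset by blast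
  qed
  have "inj_on (\<lambda>p. card (snd p - fst p)) c"
  proof (rule inj_onI)
    have *: "p = q" if "int_le p q" "card (snd p - fst p) = card (snd q - fst q)" "p \<in> c" "q \<in> c" for p q
    proof -
      have sub: "fst q \<subseteq> fst p" "snd p \<subseteq> snd q" using that(1) by (auto simp: int_le_def)
      have "snd p - fst p = snd q - fst q"
        using sub fin(1)[OF that(4)] that(2) by (intro card_subset_eq) auto
      then have "snd p = snd q" "fst p = fst q"
        using sub fin(2)[OF that(3)] fin(2)[OF that(4)] by blast+
      then show ?thesis by (simp add: prod_eq_iff)
    qed
    fix p q assume "p \<in> c" "q \<in> c" "card (snd p - fst p) = card (snd q - fst q)"
    then show "p = q" using c(2) *[of p q] *[of q p] by auto
  qed
  moreover have "(\<lambda>p. card (snd p - fst p)) ` c \<subseteq> {..<card F}"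
  proof
    fix k assume "k \<in> (\<lambda>p. card (snd p - fst p)) ` c"
    then obtain p where p: "p \<in> c" "k = card (snd p - fst p)" by auto
    have "snd p - fst p \<subset> F" using fin[OF p(1)] by blast
    then show "k \<in> {..<card F}" using p assms(1) by (simp add: psubset_card_mono)
  qed
  ultimately have "card c \<le> card {..<card F}" by (intro card_inj_on_le) auto
  then show ?thesis by simp
qed

text \<open>Fix the lower end \<open>{a}\<close> and enlarge the upper end by one element at a time,
  starting from \<open>{a}\<close>.\<close>

lemma interval_chain_exists:
  assumes "finite F"
  shows "\<exists>c\<in>chains_of int_le (intervals_in F). card c = card F"
proof (cases "F = {}")
  case True
  then show ?thesis by (intro bexI[of _ "{}"]) (auto simp: chains_of_def)
next
  case False
  then obtain a F' where F: "F = insert a F'" "a \<notin> F'" by (metis mk_disjoint_insert all_not_in_conv)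
  have "finite F'" using assms F by simp
  then have "\<exists>c. finite c \<and> card c = Suc (card F') \<and> (\<forall>p\<in>c. fst p = {a} \<and> a \<in> snd p \<and> snd p \<subseteq> insert a F') \<and>
      (\<forall>p\<in>c. \<forall>q\<in>c. int_le p q \<or> int_le q p)" using F(2)
  proof (induction F' rule: finite_induct)
    case empty
    show ?case by (intro exI[of _ "{({a}, {a})}"]) (auto simp: int_le_def)
  next
    case (insert b G)
    then obtain c where c: "finite c" "card c = Suc (card G)"
      "\<forall>p\<in>c. fst p = {a} \<and> a \<in> snd p \<and> snd p \<subseteq> insert a G" "\<forall>p\<in>c. \<forall>q\<in>c. int_le p q \<or> int_le q p" by auto
    let ?t = "({a}, insert a (insert b G))"
    have "?t \<notin> c"
    proof
      assume "?t \<in> c"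
      then have "insert a (insert b G) \<subseteq> insert a G" using c(3) by force
      then show False using insert.hyps(2) insert.prems by auto
    qed
    moreover have "int_le p ?t" if "p \<in> c" for p using c(3) that by (auto simp: int_le_def)
    moreover have "int_le ?t ?t" by (simp add: int_le_def)
    ultimately show ?case using c insert
      by (intro exI[of _ "insert ?t c"]) auto
  qed
  then obtain c where c: "card c = Suc (card F')" "\<forall>p\<in>c. fst p = {a} \<and> a \<in> snd p \<and> snd p \<subseteq> insert a F'"
      "\<forall>p\<in>c. \<forall>q\<in>c. int_le p q \<or> int_le q p" by blast
  then have "c \<in> chains_of int_le (intervals_in F)"
    using F by (fastforce simp: chains_of_def intervals_in_def)
  then show ?thesis using c(1) F \<open>finite F'\<close> by auto
qed

section \<open>The h-polynomials of the restrictions of the complex\<close>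

lemma poly_eq_cofinite:
  fixes p q :: "real poly"
  assumes "finite A" "\<And>x. x \<notin> A \<Longrightarrow> poly p x = poly q x"
  shows "p = q"
proof (rule ccontr)
  assume "p \<noteq> q"
  then have "finite {x. poly (p - q) x = 0}" by (intro poly_roots_finite) simp
  moreover have "- A \<subseteq> {x. poly (p - q) x = 0}" using assms(2) by auto
  ultimately have "finite (- A)" by (rule rev_finite_subset)
  then show False using assms(1) infinite_UNIV_char_0[where ?'a = real] by (simp add: finite_compl)
qed

lemma h_poly_intervals_in:
  assumes "finite F"
  shows "h_poly (chains_of int_le (intervals_in F)) = Bplus (card F)"
proof (rule poly_eq_cofinite[of "{1}"])
  fix x :: real assume "x \<notin> {1}"
  then have x: "x \<noteq> 1" by simp
  let ?C = "chains_of int_le (intervals_in F)"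
  have fin: "finite ?C"
    by (rule finite_subset[of _ "Pow (intervals_in F)"])
       (use finite_intervals_in[OF assms] in \<open>auto simp: chains_of_def\<close>)
  obtain c where c: "c \<in> ?C" "card c = card F" using interval_chain_exists[OF assms] by auto
  \<comment> \<open>\<open>h_poly\<close> reads the dimension off the faces, so the bound on chains
    and a chain attaining it are both required here.\<close>
  have "Max (card ` ?C) = card F"
    using fin c interval_chain_card_le[OF assms] by (intro Max_eqI) (auto intro: image_eqI[of _ _ c])
  then have "poly (h_poly ?C) x = (\<Sum>c\<in>?C. x ^ card c * (1 - x) ^ (card F - card c))"
    by (simp add: h_poly_def Let_def poly_sum poly_monom)
  also have "\<dots> = (\<Sum>c\<in>?C. (1 - x) ^ card F * (x / (1 - x)) ^ card c)"
  proof (rule sum.cong[OF refl])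
    fix c assume "c \<in> ?C"
    then have "(1 - x) ^ card F = (1 - x) ^ (card F - card c) * (1 - x) ^ card c"
      using interval_chain_card_le[OF assms] by (simp flip: power_add)
    then show "x ^ card c * (1 - x) ^ (card F - card c) = (1 - x) ^ card F * (x / (1 - x)) ^ card c"
      using x by (simp add: power_divide)
  qed
  also have "\<dots> = poly (Bplus (card F)) x"
    using x by (simp add: sum_chains_intervals_in[OF x assms] flip: sum_distrib_left)
  finally show "poly (h_poly ?C) x = poly (Bplus (card F)) x" .
qed simp

text \<open>The carrier is the upper end of the top interval, and this contains all other upper ends
  of the chain. The empty chain has empty carrier and lies in every restriction.\<close>

lemma K_restrict:
  assumes "F \<subseteq> {1..n}"
  shows "{G \<in> K n. K_carrier G \<subseteq> F} = chains_of int_le (intervals_in F)"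
proof -
  have "G \<subseteq> intervals n \<and> K_carrier G \<subseteq> F \<longleftrightarrow> G \<subseteq> intervals_in F"
    if G: "\<forall>p\<in>G. \<forall>q\<in>G. int_le p q \<or> int_le q p" for G
  proof (cases "G = {}")
    case True
    then show ?thesis by (simp add: K_carrier_def)
  next
    case False
    have top: "\<exists>m\<in>G. (\<forall>p\<in>G. int_le p m) \<and> K_carrier G = snd m" if fG: "finite G"
    proof -
      obtain m where m: "m \<in> G" "\<forall>p\<in>G. int_le p m"
        using chain_has_top[OF fG False G int_le_order(2)] by blast
      then show ?thesis using False chain_top_eq[OF int_le_order(3) m] by (auto simp: K_carrier_def)
    qed
    have fin: "finite (intervals_in {1..n})" by (rule finite_intervals_in) simp
    have eq: "intervals n = intervals_in {1..n}" by (simp add: intervals_def intervals_in_def)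
    have sub: "intervals_in F \<subseteq> intervals n" using assms by (auto simp: eq intervals_in_def)
    show ?thesis
    proof
      assume *: "G \<subseteq> intervals n \<and> K_carrier G \<subseteq> F"
      then have "finite G" using fin eq by (metis finite_subset)
      then obtain m where m: "\<forall>p\<in>G. int_le p m" "K_carrier G = snd m" using top by blast
      have "p \<in> intervals_in F" if "p \<in> G" for p
      proof -
        have "snd p \<subseteq> snd m" "snd m \<subseteq> F" using m that * by (auto simp: int_le_def)
        then have "snd p \<subseteq> F" by blast
        moreover have "p \<in> intervals n" using that * by blast
        ultimately show ?thesis by (auto simp: intervals_def intervals_in_def)
      qed
      then show "G \<subseteq> intervals_in F" by blast
    next
      assume *: "G \<subseteq> intervals_in F"
      then have "finite G" using fin eq sub by (metis finite_subset)
      then obtain m where "m \<in> G" "K_carrier G = snd m" using top by blast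
      moreover from this have "m \<in> intervals_in F" using * by blast
      then have "snd m \<subseteq> F" by (auto simp: intervals_in_def)
      ultimately show "G \<subseteq> intervals n \<and> K_carrier G \<subseteq> F" using * sub by auto
    qed
  qed
  then show ?thesis by (auto simp: K_def chains_of_def)
qed

lemma local_h_K:
  "local_h {1..n} (K n) K_carrier = (\<Sum>k\<le>n. smult ((-1) ^ (n - k) * real (n choose k)) (Bplus k))"
proof -
  have "local_h {1..n} (K n) K_carrier =
    (\<Sum>F\<in>Pow {1..n}. smult ((-1) ^ (n - card F)) (Bplus (card F)))"
    unfolding local_h_def
    by (intro sum.cong refl) (auto simp: K_restrict h_poly_intervals_in finite_subset)
  also have "\<dots> = (\<Sum>k\<le>n. of_nat (n choose k) * smult ((-1) ^ (n - k)) (Bplus k))"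
    by (subst sum_Pow_by_card) auto
  finally show ?thesis by (simp add: of_nat_poly mult.commute)
qed

section \<open>Exponential generating functions\<close>

definition egf :: "(nat \<Rightarrow> real) \<Rightarrow> real fps" where
  "egf a = Abs_fps (\<lambda>n. a n / fact n)"

lemma egf_eq_iff: "egf a = egf b \<longleftrightarrow> a = b"
  by (auto simp: egf_def fps_eq_iff fun_eq_iff)

lemma egf_power: "egf (\<lambda>n. c ^ n) = fps_exp c"
  by (simp add: egf_def fps_eq_iff)

lemma egf_add: "egf a + egf b = egf (\<lambda>n. a n + b n)"
  by (simp add: egf_def fps_eq_iff add_divide_distrib)

lemma egf_diff: "egf a - egf b = egf (\<lambda>n. a n - b n)"
  by (simp add: egf_def fps_eq_iff diff_divide_distrib)

lemma egf_const: "fps_const c * egf a = egf (\<lambda>n. c * a n)"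
  by (simp add: egf_def fps_eq_iff)

lemma egf_mult: "egf a * egf b = egf (\<lambda>n. \<Sum>k\<le>n. real (n choose k) * (a (n - k) * b k))"
proof (rule fps_ext)
  fix n
  have "fps_nth (egf b * egf a) n = (\<Sum>k\<le>n. b k / fact k * (a (n - k) / fact (n - k)))"
    by (simp add: egf_def fps_mult_nth atMost_atLeast0)
  also have "\<dots> = (\<Sum>k\<le>n. real (n choose k) * (a (n - k) * b k) / fact n)"
    by (intro sum.cong refl) (auto simp: binomial_fact field_simps)
  finally show "fps_nth (egf a * egf b) n = fps_nth (egf (\<lambda>n. \<Sum>k\<le>n. real (n choose k) * (a (n - k) * b k))) n"
    unfolding mult.commute[of "egf a"] by (simp add: egf_def sum_divide_distrib)
qed

lemma one_minus_fps_const: "1 - fps_const x = fps_const (1 - x :: real)"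
  by (simp flip: fps_const_1_eq_1)

text \<open>Multiplying the block recursion by \<open>1 - x\<close> completes its powers to
  \<open>(2 * (1 - x)) ^ (n - k)\<close>. With the summand \<open>k = n\<close> added on both sides,
  the sum is a binomial convolution.\<close>

lemma egf_eB:
  fixes x :: real
  defines "B \<equiv> egf (\<lambda>n. poly (eB n) x)"
  shows "B = (1 - fps_const x) * fps_exp (1 - x) + fps_const x * fps_exp (2 * (1 - x)) * B"
proof -
  have *: "poly (eB n) x = (1 - x) * (1 - x) ^ n +
      x * (\<Sum>k\<le>n. real (n choose k) * ((2 * (1 - x)) ^ (n - k) * poly (eB k) x))" for n
  proof -
    have "(1 - x) * poly (eB n) x = (1 - x) * (1 - x) ^ n +
      (\<Sum>k<n. x * (real (n choose k) * ((2 * (1 - x)) ^ (n - k) * poly (eB k) x)))"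
      unfolding poly_eB_rec[of n] distrib_left sum_distrib_left
    proof (intro arg_cong2[where f = "(+)"] refl sum.cong)
      fix k assume "k \<in> {..<n}"
      then have "(1 - x) ^ (n - k) = (1 - x) * (1 - x) ^ (n - k - 1)"
        by (simp add: Suc_diff_Suc flip: power_Suc)
      then show "(1 - x) * (real (n choose k) * (2 ^ (n - k) * (x * (1 - x) ^ (n - k - 1) * poly (eB k) x))) =
        x * (real (n choose k) * ((2 * (1 - x)) ^ (n - k) * poly (eB k) x))"
        unfolding power_mult_distrib by (simp only: mult_ac)
    qed
    then show ?thesis
      by (simp add: sum_distrib_left algebra_simps flip: lessThan_Suc_atMost)
  qed
  show ?thesis
    unfolding B_def one_minus_fps_const mult.assoc egf_power[symmetric] egf_mult
    unfolding egf_const egf_add egf_eq_iff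
    by (intro ext *)
qed

text \<open>As for \<open>eB\<close>, except that the factor \<open>2 ^ (n - k) - 1\<close> yields a
  difference of two exponentials. It vanishes at \<open>k = n\<close>, so the sum extends to
  \<open>k = n\<close> for free and \<open>1 - x\<close> stays on the left.\<close>

lemma egf_Bplus:
  fixes x :: real
  defines "B \<equiv> egf (\<lambda>n. poly (eB n) x)" and "P \<equiv> egf (\<lambda>n. poly (Bplus n) x)"
  shows "(1 - fps_const x) * P = (1 - fps_const x) * fps_exp (1 - x) +
    fps_const x * (fps_exp (2 * (1 - x)) - fps_exp (1 - x)) * B"
proof -
  have *: "(1 - x) * poly (Bplus n) x = (1 - x) * (1 - x) ^ n +
      x * (\<Sum>k\<le>n. real (n choose k) * (((2 * (1 - x)) ^ (n - k) - (1 - x) ^ (n - k)) * poly (eB k) x))" for n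
  proof -
    have "(1 - x) * poly (Bplus n) x = (1 - x) * (1 - x) ^ n +
      (\<Sum>k<n. x * (real (n choose k) * (((2 * (1 - x)) ^ (n - k) - (1 - x) ^ (n - k)) * poly (eB k) x)))"
      unfolding poly_Bplus_rec[of n] distrib_left sum_distrib_left
    proof (intro arg_cong2[where f = "(+)"] refl sum.cong)
      fix k assume "k \<in> {..<n}"
      then have 1: "(1 - x) ^ (n - k) = (1 - x) * (1 - x) ^ (n - k - 1)"
        by (simp add: Suc_diff_Suc flip: power_Suc)
      have "(2 * (1 - x)) ^ (n - k) - (1 - x) ^ (n - k) = (2 ^ (n - k) - 1) * ((1 - x) * (1 - x) ^ (n - k - 1))"
        unfolding power_mult_distrib 1 by (simp only: left_diff_distrib mult_1)
      then show "(1 - x) * (real (n choose k) * ((2 ^ (n - k) - 1) * (x * (1 - x) ^ (n - k - 1) * poly (eB k) x))) =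
        x * (real (n choose k) * (((2 * (1 - x)) ^ (n - k) - (1 - x) ^ (n - k)) * poly (eB k) x))"
        by (simp only: mult_ac)
    qed
    then show ?thesis
      by (simp add: sum_distrib_left flip: lessThan_Suc_atMost)
  qed
  show ?thesis
    unfolding B_def P_def one_minus_fps_const mult.assoc egf_power[symmetric] egf_diff egf_mult
    unfolding egf_const egf_add egf_eq_iff
    by (intro ext *)
qed

text \<open>Eliminates the series \<open>b\<close> of \<open>eB\<close> from the two equations
  above, where \<open>c\<close> is the constant \<open>x\<close>, \<open>a\<close> the exponential
  with rate \<open>1 - x\<close>, and \<open>p\<close> the series of \<open>Bplus\<close>. The
  common factor \<open>1 - c\<close> cancels in the domain.\<close>

lemma linear_system_solve:
  fixes a c b p :: "'a::idom"
  assumes "b = (1 - c) * a + c * (a * a) * b" "(1 - c) * p = (1 - c) * a + c * (a * a - a) * b" "c \<noteq> 1"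
  shows "p = a - c * (a * a) + c * (a * a) * p"
proof -
  have "(1 - c) * (p - c * (a * a) * p) = (1 - c) * p - c * (a * a) * ((1 - c) * p)"
    by (simp add: algebra_simps)
  also have "\<dots> = (1 - c) * (a - c * (a * a) * a) + c * (a * a - a) * (b - c * (a * a) * b)"
    unfolding assms(2) by (simp add: algebra_simps)
  also have "b - c * (a * a) * b = (1 - c) * a" using assms(1) by (simp add: algebra_simps)
  also have "(1 - c) * (a - c * (a * a) * a) + c * (a * a - a) * ((1 - c) * a) = (1 - c) * (a - c * (a * a))"
    by (simp add: algebra_simps)
  finally have "p - c * (a * a) * p = a - c * (a * a)" using assms(3) by simp
  then show ?thesis by (simp add: algebra_simps)
qed

section \<open>Binomial transforms and their generating functions\<close>

definition binomial_transform :: "(nat \<Rightarrow> real poly) \<Rightarrow> nat \<Rightarrow> real poly" where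
  "binomial_transform f n = (\<Sum>k\<le>n. smult ((-1) ^ (n - k) * real (n choose k)) (f k))"

lemma egf_binomial_transform:
  "egf (\<lambda>n. poly (binomial_transform f n) x) = fps_exp (-1) * egf (\<lambda>n. poly (f n) x)"
  unfolding egf_power[symmetric] egf_mult egf_eq_iff
  by (simp add: fun_eq_iff binomial_transform_def poly_sum mult_ac)

lemma egf_transform_Bplus:
  assumes "x \<noteq> 1"
  defines "P \<equiv> egf (\<lambda>n. poly (binomial_transform Bplus n) x)"
  shows "(fps_exp (2 * x) - fps_const x * fps_exp 2) * P = fps_exp x - fps_const x * fps_exp 1"
proof -
  let ?c = "fps_const x" and ?p = "egf (\<lambda>n. poly (Bplus n) x)" and ?a = "fps_exp (1 - x)"
  have aa: "fps_exp (2 * (1 - x)) = ?a * ?a" by (simp flip: fps_exp_add_mult)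
  have c: "?c \<noteq> 1" 
  proof
    assume "?c = 1"
    then have "fps_nth ?c 0 = fps_nth 1 0" by simp
    then show False using assms by simp
  qed
  have p: "?p = ?a - ?c * (?a * ?a) + ?c * (?a * ?a) * ?p"
    using egf_eB[of x] egf_Bplus[of x] c unfolding aa by (rule linear_system_solve)
  \<comment> \<open>The first factor is the binomial transform; the second turns the denominator
    \<open>1 - ?c * (?a * ?a)\<close> into \<open>fps_exp (2 * x) - ?c * fps_exp 2\<close>.\<close>
  let ?e = "fps_exp (- 1) * fps_exp (2 * x) :: real fps"
  have 1: "?e * ?a = fps_exp x" "?e * (?a * ?a) = fps_exp 1"
     "fps_exp (2 * x) * (?a * ?a) = fps_exp 2"
    by (simp_all flip: fps_exp_add_mult)
  have "(fps_exp (2 * x) - ?c * fps_exp 2) * P = fps_exp (2 * x) * (fps_exp (-1) * ?p) - ?c * (fps_exp (2 * x) * (?a * ?a)) * (fps_exp (-1) * ?p)"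
    unfolding P_def egf_binomial_transform 1 by (simp add: algebra_simps)
  also have "\<dots> = ?e * (?p - ?c * (?a * ?a) * ?p)" by (simp add: algebra_simps)
  also have "?p - ?c * (?a * ?a) * ?p = ?a - ?c * (?a * ?a)" using p by (simp add: algebra_simps)
  also have "?e * (?a - ?c * (?a * ?a)) = ?e * ?a - ?c * (?e * (?a * ?a))" by (simp add: algebra_simps)
  finally show ?thesis by (simp only: 1)
qed

lemma egf_transform_eB:
  fixes x :: real
  defines "D \<equiv> egf (\<lambda>n. poly (binomial_transform eB n) x)"
  shows "(fps_exp (2 * x) - fps_const x * fps_exp 2) * D = (1 - fps_const x) * fps_exp x"
proof -
  let ?c = "fps_const x" and ?b = "egf (\<lambda>n. poly (eB n) x)" and ?a = "fps_exp (1 - x)"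
  have aa: "fps_exp (2 * (1 - x)) = ?a * ?a" by (simp flip: fps_exp_add_mult)
  have b: "?b = (1 - ?c) * ?a + ?c * (?a * ?a) * ?b" using egf_eB[of x] unfolding aa .
  let ?e = "fps_exp (- 1) * fps_exp (2 * x) :: real fps"
  have 1: "?e * ?a = fps_exp x" "fps_exp (2 * x) * (?a * ?a) = fps_exp 2"
    by (simp_all flip: fps_exp_add_mult)
  have "(fps_exp (2 * x) - ?c * fps_exp 2) * D = fps_exp (2 * x) * (fps_exp (-1) * ?b) - ?c * (fps_exp (2 * x) * (?a * ?a)) * (fps_exp (-1) * ?b)"
    unfolding D_def egf_binomial_transform 1 by (simp add: algebra_simps)
  also have "\<dots> = ?e * (?b - ?c * (?a * ?a) * ?b)" by (simp add: algebra_simps)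
  also have "?b - ?c * (?a * ?a) * ?b = (1 - ?c) * ?a" using b by (simp add: algebra_simps)
  also have "?e * ((1 - ?c) * ?a) = (1 - ?c) * (?e * ?a)" by (simp add: mult_ac)
  finally show ?thesis by (simp only: 1)
qed

lemma binomial_transform_add:
  "binomial_transform (\<lambda>n. f n + g n) n = binomial_transform f n + binomial_transform g n"
  by (simp add: binomial_transform_def smult_add_right sum.distrib)

lemma egf_transform_Bminus:
  assumes "x \<noteq> 1"
  defines "M \<equiv> egf (\<lambda>n. poly (binomial_transform Bminus n) x)"
  shows "(fps_exp (2 * x) - fps_const x * fps_exp 2) * M = fps_const x * (fps_exp 1 - fps_exp x)"
proof -
  have "M = egf (\<lambda>n. poly (binomial_transform eB n) x) - egf (\<lambda>n. poly (binomial_transform Bplus n) x)"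
    unfolding M_def egf_diff egf_eq_iff Bplus_plus_Bminus[symmetric] binomial_transform_add by simp
  then have "(fps_exp (2 * x) - fps_const x * fps_exp 2) * M =
      (1 - fps_const x) * fps_exp x - (fps_exp x - fps_const x * fps_exp 1)"
    using egf_transform_eB[of x] egf_transform_Bplus[OF assms(1)] by (simp only: right_diff_distrib)
  then show ?thesis by (simp add: algebra_simps)
qed

text \<open>Comparison of coefficients: the \<open>k\<close>-th coefficient of the denominator,
  scaled by \<open>fact k\<close>, is \<open>2 ^ k * (x ^ k - x)\<close>. Its value
  \<open>1 - x\<close> at \<open>k = 0\<close> remains on the left.\<close>

lemma egf_recurrence:
  assumes "(fps_exp (2 * x) - fps_const x * fps_exp 2) * egf a = egf r"
  shows "(1 - x) * a n = r n + (\<Sum>k=1..n. real (n choose k) * 2 ^ k * (x - x ^ k) * a (n - k))"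
proof -
  have "egf r = egf a * egf (\<lambda>n. (2 * x) ^ n - x * 2 ^ n)"
    unfolding egf_diff[symmetric] egf_const[symmetric] egf_power using assms by (simp add: mult.commute)
  then have "r n = (\<Sum>k\<le>n. real (n choose k) * (a (n - k) * ((2 * x) ^ k - x * 2 ^ k)))"
    unfolding egf_mult egf_eq_iff by (simp add: fun_eq_iff)
  also have "\<dots> = a n * (1 - x) + (\<Sum>k=1..n. real (n choose k) * (a (n - k) * ((2 * x) ^ k - x * 2 ^ k)))"
    by (simp add: atMost_atLeast0 sum.atLeast_Suc_atMost)
  also have "(\<Sum>k=1..n. real (n choose k) * (a (n - k) * ((2 * x) ^ k - x * 2 ^ k))) =
      - (\<Sum>k=1..n. real (n choose k) * 2 ^ k * (x - x ^ k) * a (n - k))"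
    unfolding sum_negf[symmetric] by (intro sum.cong refl) (simp add: power_mult_distrib algebra_simps)
  finally show ?thesis by (simp add: algebra_simps)
qed

text \<open>The quotient of \<open>x - x ^ k\<close> by \<open>1 - x\<close> for
  \<open>k \<ge> 1\<close>; it is zero for \<open>k = 1\<close>.\<close>

definition qpoly :: "nat \<Rightarrow> real poly" where
  "qpoly k = (\<Sum>j=1..<k. monom 1 j)"

lemma qpoly_mult: "k \<ge> 1 \<Longrightarrow> [:1, -1:] * qpoly k = [:0, 1:] - monom 1 k"
proof (induction k rule: nat_induct_at_least)
  case base
  then show ?case by (simp add: qpoly_def monom_altdef)
next
  case (Suc k)
  have "qpoly (Suc k) = qpoly k + monom 1 k" using Suc.hyps by (simp add: qpoly_def)
  then have "[:1, -1:] * qpoly (Suc k) = [:0, 1:] - monom 1 k + [:1, -1:] * monom 1 k"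
    by (simp only: distrib_left Suc.IH)
  then show ?case by (simp add: monom_altdef)
qed

lemma poly_qpoly: "k \<ge> 1 \<Longrightarrow> (1 - x) * poly (qpoly k) x = x - x ^ k"
  using arg_cong[OF qpoly_mult[of k], of "\<lambda>p. poly p x"] by (simp add: poly_monom algebra_simps)

text \<open>Divides \<open>egf_recurrence\<close> by \<open>1 - x\<close>: each
  \<open>x - x ^ k\<close> becomes \<open>qpoly k\<close>, and \<open>s n\<close> is the quotient of
  the right-hand side \<open>r x n\<close>. Agreement at all points except 1 suffices for
  polynomials.\<close>

lemma poly_recurrence:
  fixes a :: "nat \<Rightarrow> real poly"
  assumes "\<And>x. x \<noteq> 1 \<Longrightarrow> (fps_exp (2 * x) - fps_const x * fps_exp 2) * egf (\<lambda>n. poly (a n) x) = egf (r x)"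
    and "\<And>x. (1 - x) * poly (s n) x = r x n"
  shows "a n = s n + (\<Sum>k=1..n. smult (real (n choose k) * 2 ^ k) (qpoly k * a (n - k)))"
proof (rule poly_eq_cofinite[of "{1}"])
  fix x :: real assume "x \<notin> {1}"
  then have x: "x \<noteq> 1" by simp
  have "(1 - x) * poly (a n) x = (1 - x) * poly (s n) x +
      (\<Sum>k=1..n. real (n choose k) * 2 ^ k * (x - x ^ k) * poly (a (n - k)) x)"
    using egf_recurrence[OF assms(1)[OF x]] assms(2) by simp
  also have "(\<Sum>k=1..n. real (n choose k) * 2 ^ k * (x - x ^ k) * poly (a (n - k)) x) =
      (1 - x) * (\<Sum>k=1..n. real (n choose k) * 2 ^ k * (poly (qpoly k) x * poly (a (n - k)) x))"
    unfolding sum_distrib_left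
    by (intro sum.cong refl) (simp add: poly_qpoly[symmetric] mult_ac)
  finally have "(1 - x) * poly (a n) x = (1 - x) * (poly (s n) x +
      (\<Sum>k=1..n. real (n choose k) * 2 ^ k * (poly (qpoly k) x * poly (a (n - k)) x)))"
    by (simp only: distrib_left)
  then show "poly (a n) x = poly (s n + (\<Sum>k=1..n. smult (real (n choose k) * 2 ^ k) (qpoly k * a (n - k)))) x"
    using x by (simp add: poly_sum)
qed simp

text \<open>Every term on the right has nonnegative coefficients and center of symmetry \<open>n / 2\<close>.\<close>

lemma transform_Bplus_rec:
  assumes "n \<ge> 1"
  shows "binomial_transform Bplus n = smult (2 ^ n - 1) (qpoly n) +
    (\<Sum>k=1..<n. smult (real (n choose k) * 2 ^ k) (qpoly k * binomial_transform Bplus (n - k)))"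
proof -
  have "binomial_transform Bplus n = - qpoly n +
     (\<Sum>k=1..n. smult (real (n choose k) * 2 ^ k) (qpoly k * binomial_transform Bplus (n - k)))"
  proof (rule poly_recurrence[where s = "\<lambda>n. - qpoly n" and r = "\<lambda>x n. x ^ n - x"])
    fix x :: real assume "x \<noteq> 1"
    show "(fps_exp (2 * x) - fps_const x * fps_exp 2) * egf (\<lambda>n. poly (binomial_transform Bplus n) x) =
      egf (\<lambda>n. x ^ n - x)"
      unfolding egf_transform_Bplus[OF \<open>x \<noteq> 1\<close>]
    unfolding egf_power[symmetric] egf_const egf_diff
      by simp
  next
    fix x :: real show "(1 - x) * poly (- qpoly n) x = x ^ n - x"
      using poly_qpoly[OF assms, of x] by simp
  qed
  \<comment> \<open>The summand \<open>k = n\<close> is therefore \<open>2 ^ n\<close> times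
    \<open>qpoly n\<close>; it absorbs the negative term \<open>- qpoly n\<close> and leaves the
    nonnegative factor \<open>2 ^ n - 1\<close>.\<close>
  moreover have "binomial_transform Bplus 0 = 1" by (simp add: binomial_transform_def Bplus_def)
  moreover have "{1..n} = insert n {1..<n}" using assms by auto
  ultimately show ?thesis by (simp add: smult_diff_left)
qed

text \<open>The inhomogeneous term is \<open>x * (1 - x ^ n) / (1 - x)\<close>, which is
  \<open>qpoly (Suc n)\<close>. Its center of symmetry \<open>(n + 1) / 2\<close> is the one
  expected of \<open>f^-_n\<close>.\<close>

lemma transform_Bminus_rec:
  "binomial_transform Bminus n = qpoly (Suc n) +
    (\<Sum>k=1..n. smult (real (n choose k) * 2 ^ k) (qpoly k * binomial_transform Bminus (n - k)))"
proof (rule poly_recurrence[where s = "\<lambda>n. qpoly (Suc n)" and r = "\<lambda>x n. x * (1 - x ^ n)"])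
  fix x :: real assume "x \<noteq> 1"
  show "(fps_exp (2 * x) - fps_const x * fps_exp 2) * egf (\<lambda>n. poly (binomial_transform Bminus n) x) =
    egf (\<lambda>n. x * (1 - x ^ n))"
    unfolding egf_transform_Bminus[OF \<open>x \<noteq> 1\<close>]
    unfolding egf_power[symmetric] egf_diff egf_const
    by simp
next
  fix x :: real show "(1 - x) * poly (qpoly (Suc n)) x = x * (1 - x ^ n)"
    using poly_qpoly[of "Suc n" x] by (simp add: algebra_simps)
qed

section \<open>Symmetry and unimodality\<close>

text \<open>Stated through values, as in \<open>fpm_decomp\<close>. The bound \<open>n\<close> on
  the degree is a consequence, contained in \<open>palindromic_coeff\<close>.\<close>

definition palindromic :: "nat \<Rightarrow> real poly \<Rightarrow> bool" where
  "palindromic n p \<longleftrightarrow> (\<forall>x. x \<noteq> 0 \<longrightarrow> poly p x = x ^ n * poly p (1 / x))"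

lemma palindromicD: "palindromic n p \<Longrightarrow> x \<noteq> 0 \<Longrightarrow> x ^ n * poly p (1 / x) = poly p x"
  unfolding palindromic_def by metis

lemma palindromicI: "(\<And>x. x \<noteq> 0 \<Longrightarrow> x ^ n * poly p (1 / x) = poly p x) \<Longrightarrow> palindromic n p"
  unfolding palindromic_def by metis

lemma palindromic_add:
  assumes "palindromic n p" "palindromic n q"
  shows "palindromic n (p + q)"
  using palindromicD[OF assms(1)] palindromicD[OF assms(2)]
  by (intro palindromicI) (simp add: distrib_left)

lemma palindromic_smult:
  assumes "palindromic n p"
  shows "palindromic n (smult c p)"
  using palindromicD[OF assms] by (intro palindromicI) (simp add: mult.left_commute)

lemma palindromic_diff:
  assumes "palindromic n p" "palindromic n q"
  shows "palindromic n (p - q)"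
  using palindromicD[OF assms(1)] palindromicD[OF assms(2)]
  by (intro palindromicI) (simp add: right_diff_distrib)

lemma palindromic_sum:
  assumes "\<And>i. i \<in> A \<Longrightarrow> palindromic n (f i)"
  shows "palindromic n (\<Sum>i\<in>A. f i)"
  using palindromicD[OF assms] by (intro palindromicI) (simp add: poly_sum sum_distrib_left)

lemma palindromic_mult:
  assumes "palindromic m p" "palindromic n q"
  shows "palindromic (m + n) (p * q)"
proof (rule palindromicI)
  fix x :: real assume x: "x \<noteq> 0"
  have "x ^ (m + n) * poly (p * q) (1 / x) = (x ^ m * poly p (1 / x)) * (x ^ n * poly q (1 / x))"
    by (simp add: power_add mult_ac)
  then show "x ^ (m + n) * poly (p * q) (1 / x) = poly (p * q) x"
    by (simp only: palindromicD[OF assms(1) x] palindromicD[OF assms(2) x] poly_mult)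
qed

lemma palindromic_qpoly: "palindromic k (qpoly k)"
proof (rule palindromicI)
  fix x :: real assume x: "x \<noteq> 0"
  have "x ^ k * poly (qpoly k) (1 / x) = (\<Sum>j=1..<k. x ^ k * (1 / x) ^ j)"
    by (simp add: qpoly_def poly_sum poly_monom sum_distrib_left)
  also have "\<dots> = (\<Sum>j=1..<k. x ^ (k - j))"
    using x by (intro sum.cong refl) (simp add: power_diff power_one_over)
  also have "\<dots> = (\<Sum>j=1..<k. x ^ j)"
    by (rule sum.reindex_bij_witness[of _ "\<lambda>j. k - j" "\<lambda>j. k - j"]) auto
  finally show "x ^ k * poly (qpoly k) (1 / x) = poly (qpoly k) x"
    by (simp add: qpoly_def poly_sum poly_monom)
qed

lemma palindromic_coeff:
  assumes "palindromic n p"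
  shows "coeff p i = (if i \<le> n then coeff p (n - i) else 0)"
proof -
  define d where "d = degree p"
  \<comment> \<open>\<open>reflect_poly\<close> reflects at the true degree \<open>d\<close>, which
    may differ from \<open>n\<close>; the two monomials compensate for the difference.\<close>
  have "monom 1 d * p = monom 1 n * reflect_poly p"
  proof (rule poly_eq_cofinite[of "{0}"])
    fix x :: real assume "x \<notin> {0}"
    then have x: "x \<noteq> 0" by simp
    have "poly (monom 1 n * reflect_poly p) x = x ^ d * (x ^ n * poly p (1 / x))"
      using x by (simp add: poly_monom poly_reflect_poly_nz d_def inverse_eq_divide)
    then show "poly (monom 1 d * p) x = poly (monom 1 n * reflect_poly p) x"
      unfolding palindromicD[OF assms x] by (simp add: poly_monom)
  qed simp
  then have "coeff (monom 1 d * p) (d + i) = coeff (monom 1 n * reflect_poly p) (d + i)" by simp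
  then have "coeff p i = (if d + i < n then 0 else coeff (reflect_poly p) (d + i - n))"
    by (simp add: coeff_monom_mult)
  also have "\<dots> = (if i \<le> n then coeff p (n - i) else 0)"
    by (auto simp: coeff_reflect_poly d_def coeff_eq_0)
  finally show ?thesis .
qed

text \<open>Only the ascent up to the center \<open>n / 2\<close> is recorded; the descent after it
  follows by symmetry. Fixing the center makes the property stable under sums.\<close>

definition sym_unimodal :: "nat \<Rightarrow> real poly \<Rightarrow> bool" where
  "sym_unimodal n p \<longleftrightarrow> palindromic n p \<and> (\<forall>i. coeff p i \<ge> 0) \<and>
     (\<forall>i. 2 * i + 1 \<le> n \<longrightarrow> coeff p i \<le> coeff p (Suc i))"

text \<open>The hypotheses say that \<open>i\<close> is at least as far from the center
  \<open>n / 2\<close> as \<open>j\<close> is. If \<open>j\<close> lies beyond the center, it is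
  first reflected to \<open>n - j\<close>.\<close>

lemma sym_unimodal_mono:
  assumes p: "sym_unimodal n p" and ij: "i \<le> j" "i + j \<le> n"
  shows "coeff p i \<le> coeff p j"
proof -
  have *: "coeff p i \<le> coeff p j" if "i \<le> j" "2 * j \<le> n" for j
    using that
  proof (induction j rule: dec_induct)
    case (step j)
    then have "coeff p i \<le> coeff p j" by simp
    also have "\<dots> \<le> coeff p (Suc j)" using p step.prems by (simp add: sym_unimodal_def)
    finally show ?case .
  qed simp
  show ?thesis
  proof (cases "2 * j \<le> n")
    case False
    have "coeff p i \<le> coeff p (n - j)" using False ij by (intro *) auto
    also have "\<dots> = coeff p j"
      using palindromic_coeff[of n p j] p ij by (simp add: sym_unimodal_def)
    finally show ?thesis .
  qed (use * ij in auto)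
qed

lemma sym_unimodal_add: "sym_unimodal n p \<Longrightarrow> sym_unimodal n q \<Longrightarrow> sym_unimodal n (p + q)"
  by (auto simp: sym_unimodal_def palindromic_add intro: add_mono)

lemma sym_unimodal_smult: "c \<ge> 0 \<Longrightarrow> sym_unimodal n p \<Longrightarrow> sym_unimodal n (smult c p)"
  by (auto simp: sym_unimodal_def palindromic_smult intro: mult_left_mono)

lemma sym_unimodal_sum: "(\<And>i. i \<in> A \<Longrightarrow> sym_unimodal n (f i)) \<Longrightarrow> sym_unimodal n (\<Sum>i\<in>A. f i)"
  by (auto simp: sym_unimodal_def palindromic_sum coeff_sum intro!: sum_nonneg sum_mono)

text \<open>Multiplication by \<open>1 - x\<close> telescopes: consecutive coefficients of the
  product differ by \<open>coeff p i - coeff p (Suc i - k)\<close>, with no second term for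
  \<open>Suc i < k\<close>. The two indices add up to \<open>2 * i + 1 - k\<close>, at most
  \<open>n\<close>, so \<open>sym_unimodal_mono\<close> applies.\<close>

lemma sym_unimodal_qpoly_mult:
  assumes p: "sym_unimodal n p" and k: "k \<ge> 1"
  shows "sym_unimodal (k + n) (qpoly k * p)"
  unfolding sym_unimodal_def
proof (intro conjI allI impI)
  show "palindromic (k + n) (qpoly k * p)"
    using p palindromic_qpoly by (auto simp: sym_unimodal_def intro: palindromic_mult)
  have "coeff (qpoly k) i \<ge> 0" for i by (auto simp: qpoly_def coeff_sum intro!: sum_nonneg)
  then show "coeff (qpoly k * p) i \<ge> 0" for i
    using p by (auto simp: coeff_mult sym_unimodal_def intro!: sum_nonneg)
  fix i assume i: "2 * i + 1 \<le> k + n"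
  have "[:1, -1:] * (qpoly k * p) = ([:0, 1:] - monom 1 k) * p"
    by (simp only: mult.assoc[symmetric] qpoly_mult[OF k])
  then have "coeff ([:1, -1:] * (qpoly k * p)) (Suc i) = coeff (([:0, 1:] - monom 1 k) * p) (Suc i)" by simp
  then have "coeff (qpoly k * p) (Suc i) - coeff (qpoly k * p) i =
      coeff p i - (if Suc i < k then 0 else coeff p (Suc i - k))"
    by (simp add: left_diff_distrib coeff_monom_mult)
  moreover have "coeff p (Suc i - k) \<le> coeff p i" if "k \<le> Suc i"
    using that i k by (intro sym_unimodal_mono[OF p]) auto
  moreover have "coeff p i \<ge> 0" using p by (simp add: sym_unimodal_def)
  ultimately show "coeff (qpoly k * p) i \<le> coeff (qpoly k * p) (Suc i)"
    by (auto split: if_splits)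
qed

lemma sym_unimodal_1: "sym_unimodal 0 1"
  by (simp add: sym_unimodal_def palindromic_def one_pCons coeff_pCons split: nat.split)

lemma sym_unimodal_transform_Bplus: "sym_unimodal n (binomial_transform Bplus n)"
proof (induction n rule: less_induct)
  case (less n)
  show ?case
  proof (cases "n = 0")
    case True
    then show ?thesis using sym_unimodal_1 by (simp add: binomial_transform_def Bplus_def one_pCons)
  next
    case False
    have "sym_unimodal n (qpoly n)"
      using sym_unimodal_qpoly_mult[OF sym_unimodal_1, of n] False by simp
    moreover have "sym_unimodal n (qpoly k * binomial_transform Bplus (n - k))" if "k \<in> {1..<n}" for k
      using sym_unimodal_qpoly_mult[OF less[of "n - k"], of k] that by simp
    ultimately show ?thesis using False
      by (subst transform_Bplus_rec)
         (auto intro!: sym_unimodal_add sym_unimodal_smult sym_unimodal_sum)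
  qed
qed

lemma palindromic_transform_Bminus: "palindromic (n + 1) (binomial_transform Bminus n)"
proof (induction n rule: less_induct)
  case (less n)
  have "palindromic (n + 1) (qpoly k * binomial_transform Bminus (n - k))" if "k \<in> {1..n}" for k
    using palindromic_mult[OF palindromic_qpoly[of k] less[of "n - k"]] that by simp
  then show ?case
    using palindromic_qpoly[of "Suc n"]
    by (subst transform_Bminus_rec) (auto intro!: palindromic_add palindromic_sum palindromic_smult)
qed

lemma sym_unimodal_unimodal_upto:
  assumes p: "sym_unimodal n p"
  shows "unimodal_upto p n"
  unfolding unimodal_upto_def
proof (intro exI[of _ "n div 2"] conjI allI impI)
  fix i assume "i < n div 2"
  then show "coeff p i \<le> coeff p (Suc i)" by (intro sym_unimodal_mono[OF p]) auto
next
  fix i assume i: "n div 2 \<le> i \<and> i < n"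
  have pal: "palindromic n p" using p by (simp add: sym_unimodal_def)
  have c: "coeff p i = coeff p (n - i)" "coeff p (Suc i) = coeff p (n - Suc i)"
    using i palindromic_coeff[OF pal, of i] palindromic_coeff[OF pal, of "Suc i"] by auto
  show "coeff p (Suc i) \<le> coeff p i"
    unfolding c using i by (intro sym_unimodal_mono[OF p]) auto
qed simp

section \<open>Uniqueness of the symmetric decomposition\<close>

lemma palindromic_both_zero:
  assumes "palindromic n p" "palindromic (n + 1) p"
  shows "p = 0"
proof (rule poly_eq_cofinite[of "{0, 1}"])
  fix x :: real assume x: "x \<notin> {0, 1}"
  \<comment> \<open>The two symmetries differ by a factor \<open>x\<close>, so
    \<open>x * poly p x = poly p x\<close> away from 0.\<close>
  have "x * poly p x = x ^ (n + 1) * poly p (1 / x)"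
    using palindromicD[OF assms(1), of x] x by simp
  also have "\<dots> = poly p x" using palindromicD[OF assms(2), of x] x by simp
  finally have "x * poly p x = poly p x" .
  then show "poly p x = poly 0 x" using x by simp
qed simp

text \<open>For a second decomposition \<open>p + q\<close>, the polynomial
  \<open>p - ?P = ?M - q\<close> is symmetric about both \<open>n / 2\<close> and
  \<open>(n + 1) / 2\<close>, hence zero. The equivalence gives the existence and uniqueness behind
  the definite descriptions in \<open>fplus\<close> and \<open>fminus\<close>.\<close>

lemma fpm_decomp_iff:
  "fpm_decomp n p q \<longleftrightarrow> p = binomial_transform Bplus n \<and> q = binomial_transform Bminus n"
proof -
  let ?P = "binomial_transform Bplus n" and ?M = "binomial_transform Bminus n"
  have d: "fpm_decomp n p q \<longleftrightarrow> dB n = p + q \<and> palindromic n p \<and> palindromic (n + 1) q" for p q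
    by (simp add: fpm_decomp_def palindromic_def)
  have dB: "dB n = ?P + ?M"
    unfolding dB_eq_alternating_sum Bplus_plus_Bminus[symmetric] binomial_transform_add[symmetric]
    by (simp add: binomial_transform_def)
  have P: "palindromic n ?P" using sym_unimodal_transform_Bplus by (simp add: sym_unimodal_def)
  note M = palindromic_transform_Bminus[of n]
  show ?thesis
  proof
    assume "fpm_decomp n p q"
    then have pq: "?P + ?M = p + q" "palindromic n p" "palindromic (n + 1) q" using dB d by auto
    have eq: "p - ?P = ?M - q" using pq(1) by (simp add: algebra_simps)
    have "p - ?P = 0"
    proof (rule palindromic_both_zero)
      show "palindromic n (p - ?P)" using pq P by (intro palindromic_diff)
      show "palindromic (n + 1) (p - ?P)" unfolding eq using pq M by (intro palindromic_diff)
    qed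
    then show "p = ?P \<and> q = ?M" using eq by simp
  next
    assume "p = ?P \<and> q = ?M"
    then show "fpm_decomp n p q" using dB P M by (simp add: d)
  qed
qed

lemma fplus_fminus_eq:
  "fplus n = binomial_transform Bplus n" "fminus n = binomial_transform Bminus n"
proof -
  have "(THE pq. fpm_decomp n (fst pq) (snd pq)) = (binomial_transform Bplus n, binomial_transform Bminus n)"
    by (rule the_equality) (auto simp: fpm_decomp_iff prod_eq_iff)
  then show "fplus n = binomial_transform Bplus n" "fminus n = binomial_transform Bminus n"
    by (auto simp: fplus_def fminus_def)
qed

theorem theorem1p3:
  shows "(\<forall>n\<ge>1. fplus n = local_h {1..n} (K n) K_carrier \<and>
            (\<forall>i. coeff (fplus n) i \<ge> 0) \<and>
            (\<forall>i\<le>n. coeff (fplus n) i = coeff (fplus n) (n - i)) \<and>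
            unimodal_upto (fplus n) n) \<and>
         (\<forall>n. fplus n = (\<Sum>k=0..n. smult ((-1) ^ (n - k) * real (n choose k)) (Bplus k)) \<and>
              fminus n = (\<Sum>k=0..n. smult ((-1) ^ (n - k) * real (n choose k)) (Bminus k)))"
proof (intro conjI allI impI)
  fix n i :: nat
  have su: "sym_unimodal n (fplus n)" unfolding fplus_fminus_eq by (rule sym_unimodal_transform_Bplus)
  show "fplus n = local_h {1..n} (K n) K_carrier"
    by (simp only: fplus_fminus_eq local_h_K binomial_transform_def)
  show "coeff (fplus n) i \<ge> 0" using su by (simp add: sym_unimodal_def)
  show "coeff (fplus n) i = coeff (fplus n) (n - i)" if "i \<le> n"
    using su that palindromic_coeff[of n "fplus n" i] by (simp add: sym_unimodal_def)
  show "unimodal_upto (fplus n) n" using su by (rule sym_unimodal_unimodal_upto)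
  show "fplus n = (\<Sum>k=0..n. smult ((-1) ^ (n - k) * real (n choose k)) (Bplus k))"
    "fminus n = (\<Sum>k=0..n. smult ((-1) ^ (n - k) * real (n choose k)) (Bminus k))"
    by (simp_all add: fplus_fminus_eq binomial_transform_def atMost_atLeast0)
qed

end
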